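(* Let $P_t(k)$ be the probability that a node selected uniformly at random from $G_t$ has in-degree $k$, where $\{G_t\}_{t\ge 0}$ is generated by the mixed attachment network model with reciprocity with parameters $p$, $q$ and $A$ described in the context. If $0\le p\le 1$ and $0<\mathbb{E}[A]<\infty$, then $\lim_{t\to\infty}P_t(k)$ exists for all $k\ge 0$.
   Context: Model. $\{G_t\}_{t\in\{0,1,2,\ldots\}}$ is a sequence of directed networks $G_t=(V_t,E_t)$ with $n_t=|V_t|$ nodes and $e_t=|E_t|$ edges; $k_t(u)$ denotes the in-degree of node $u\in V_t$. $A$ is a random variable with values in $\{0,1,2,\ldots\}$ giving the number of new edges created by a new node, and $a_t$ denotes its $t$-th realization. The model starts from a given seed network $G_0$, which is assumed to have at least $a_1+1$ nodes. At each time $t>0$ the network evolves as follows. (M1) Growth: a new node is added to $V_{t-1}$. (M2) Mixed attachment: for a fixed $0\le p\le 1$, the new node selects and attaches to (creates edges toward) $a_t$ different nodes in $V_{t-1}$ according to the probability $$\pi_t(v\mid p)=p\,\frac{k_{t-1}(v)}{\sum_{w\in V_{t-1}}k_{t-1}(w)}+(1-p)\frac{1}{n_{t-1}}.$$ (M3) Reciprocity: each of the $a_t$ selected nodes establishes an edge to the new node with probability $0<q\le 1$ (independent Bernoulli trials). $K_t$ denotes the in-degree of a node selected uniformly at random from $G_t$, and $P_t(k)=\mathbb{P}(K_t=k)$. *)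

theory Defs
  imports "HOL-Probability.Probability" "Graph_Theory.Pair_Digraph"
begin

text \<open>
  Networks are finite digraphs without parallel arcs whose nodes are labelled by natural
  numbers; an arc (u, v) points from u to v.
\<close>

type_synonym network = "nat pair_pre_digraph"

definition total_in_degree :: "network \<Rightarrow> nat" where
  "total_in_degree G = (\<Sum>w\<in>pverts G. in_degree G w)"

definition attach_prob :: "real \<Rightarrow> network \<Rightarrow> nat \<Rightarrow> real" where
  "attach_prob p G v =
     p * (real (in_degree G v) / real (total_in_degree G)) + (1 - p) * (1 / real (card (pverts G)))"

text \<open>
  In a network without edges the preferential term is 0/0; attachment is then taken to be uniform.
\<close>

definition attach_pmf :: "real \<Rightarrow> network \<Rightarrow> nat pmf" where
  "attach_pmf p G =
     (if total_in_degree G = 0 then pmf_of_set (pverts G)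
      else embed_pmf (\<lambda>v. if v \<in> pverts G then attach_prob p G v else 0))"

lemma pmf_attach_pmf:
  assumes G: "pair_fin_digraph G" and k: "total_in_degree G \<noteq> 0" and p: "0 \<le> p" "p \<le> 1"
  shows "pmf (attach_pmf p G) v = (if v \<in> pverts G then attach_prob p G v else 0)"
proof -
  have fin: "finite (pverts G)" using G by (rule pair_fin_digraph.pair_finite_verts)
  have nonneg: "0 \<le> (if v \<in> pverts G then attach_prob p G v else 0)" for v
    using p by (simp add: attach_prob_def)
  have c: "card (pverts G) \<noteq> 0"
    using k fin by (auto simp: total_in_degree_def)
  have sum1: "(\<Sum>v\<in>pverts G. attach_prob p G v) = 1"
  proof -
    have "(\<Sum>v\<in>pverts G. attach_prob p G v) =
        p * ((\<Sum>v\<in>pverts G. real (in_degree G v)) / real (total_in_degree G)) + (1 - p)"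
      using c by (simp add: attach_prob_def sum.distrib sum_distrib_left sum_divide_distrib)
    also have "(\<Sum>v\<in>pverts G. real (in_degree G v)) = real (total_in_degree G)"
      by (simp add: total_in_degree_def)
    finally show ?thesis using k by simp
  qed
  have "(\<integral>\<^sup>+ v. ennreal (if v \<in> pverts G then attach_prob p G v else 0) \<partial>count_space UNIV) =
      (\<Sum>v\<in>pverts G. ennreal (attach_prob p G v))"
    by (subst nn_integral_count_space'[OF fin]) auto
  also have "\<dots> = ennreal (\<Sum>v\<in>pverts G. attach_prob p G v)"
    using p by (subst sum_ennreal) (auto simp: attach_prob_def)
  finally show ?thesis
    using k nonneg sum1 by (simp add: attach_pmf_def pmf_embed_pmf)
qed

text \<open>
  One draw of a node not yet in the set S of already selected nodes: the attachment distribution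
  conditioned on the complement of S.  If nodes remain but have total probability 0, then p = 1 and
  all of them have in-degree 0; the draw is then uniform among them, which is the limit of the
  general case for p tending to 1 from below.
\<close>

definition draw_new :: "real \<Rightarrow> network \<Rightarrow> nat set \<Rightarrow> nat pmf" where
  "draw_new p G S =
     (if set_pmf (attach_pmf p G) \<subseteq> S then pmf_of_set (pverts G - S)
      else cond_pmf (attach_pmf p G) (- S))"

fun select :: "real \<Rightarrow> network \<Rightarrow> nat \<Rightarrow> nat set pmf" where
  "select p G 0 = return_pmf {}"
| "select p G (Suc m) = bind_pmf (select p G m) (\<lambda>S. map_pmf (\<lambda>v. insert v S) (draw_new p G S))"

definition reciprocate :: "real \<Rightarrow> nat set \<Rightarrow> nat set pmf" where
  "reciprocate q S = map_pmf (\<lambda>b. {v \<in> S. b v}) (Pi_pmf S False (\<lambda>_. bernoulli_pmf q))"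

definition grow :: "network \<Rightarrow> nat set \<Rightarrow> nat set \<Rightarrow> network" where
  "grow G S R =
     (let u = Suc (Max (pverts G)) in
      \<lparr> pverts = insert u (pverts G), parcs = parcs G \<union> {u} \<times> S \<union> R \<times> {u} \<rparr>)"

text \<open>
  One time step in which the new node wants to create a edges.  If A is unbounded, a may
  exceed the number of present nodes; then all present nodes are selected.
\<close>

definition evolve :: "real \<Rightarrow> real \<Rightarrow> nat \<Rightarrow> network \<Rightarrow> network pmf" where
  "evolve p q a G =
     bind_pmf (select p G (min a (card (pverts G))))
       (\<lambda>S. map_pmf (grow G S) (reciprocate q S))"

text \<open>
  The law of the network at time t.  The numbers of new edges at times 1, 2, ... are independent
  with law A.  The seed is required to have at least one node more than the first of these numbers
  and may therefore be chosen depending on it; a fixed seed is the case of a constant function.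
\<close>

fun network_pmf :: "real \<Rightarrow> real \<Rightarrow> nat pmf \<Rightarrow> (nat \<Rightarrow> network) \<Rightarrow> nat \<Rightarrow> network pmf" where
  "network_pmf p q A seed 0 = map_pmf seed A"
| "network_pmf p q A seed (Suc 0) = bind_pmf A (\<lambda>a. evolve p q a (seed a))"
| "network_pmf p q A seed (Suc (Suc t)) =
     bind_pmf (network_pmf p q A seed (Suc t)) (\<lambda>G. bind_pmf A (\<lambda>a. evolve p q a G))"

definition random_node_in_degree :: "network \<Rightarrow> nat pmf" where
  "random_node_in_degree G = map_pmf (in_degree G) (pmf_of_set (pverts G))"

text \<open>
  The law of the in-degree of a node chosen uniformly at random from the (random) network at time t.
\<close>

definition in_degree_pmf :: "real \<Rightarrow> real \<Rightarrow> nat pmf \<Rightarrow> (nat \<Rightarrow> network) \<Rightarrow> nat \<Rightarrow> nat pmf" where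
  "in_degree_pmf p q A seed t = bind_pmf (network_pmf p q A seed t) random_node_in_degree"

end

theory Submission
  imports Defs
begin

text \<open>
  Conditionally on \<open>G\<^sub>1\<close> the number of nodes \<open>n\<close> is deterministic, so \<open>P\<^sub>t(k)\<close> is the expectation
  of the number \<open>N\<^sub>k\<close> of nodes of in-degree \<open>k\<close> divided by \<open>n\<close>; the average over \<open>G\<^sub>1\<close> is handled by
  dominated convergence.  Let \<open>\<mu> = E A\<close> and \<open>\<Lambda> = (1 + q) \<mu>\<close>.  If draws without replacement behaved like
  independent draws and the total in-degree were exactly \<open>\<Lambda> n\<close>, then \<open>E N\<^sub>k\<close> would satisfy a linear
  recursion with drift \<open>r\<^sub>k\<^sub>-\<^sub>1 E N\<^sub>k\<^sub>-\<^sub>1 / n - r\<^sub>k E N\<^sub>k / n\<close> where \<open>r\<^sub>k = \<mu> (p k / \<Lambda> + 1 - p)\<close>, and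
  \<open>E N\<^sub>k / n\<close> would converge by induction on \<open>k\<close>.  Two estimates justify this.

  First, the total in-degree differs from \<open>\<Lambda> n\<close> by \<open>o(n)\<close> in mean square.  No second moment of \<open>A\<close> is
  needed, because at most \<open>n\<close> nodes can be selected and \<open>E (min A n)\<^sup>2 = o(n)\<close>.

  Second, there are no hubs: the sum of the squared in-degrees is \<open>o(n\<^sup>2)\<close> in mean, hence so is the
  effect of conditioning on earlier draws.  A Chebyshev rearrangement shows that the expected in-degree of
  the drawn node does not increase from one draw to the next, so the sum of squares grows at most like
  \<open>n\<close> to the power \<open>2 / (1 + q)\<close>, up to \<open>o(n\<^sup>2)\<close>; here \<open>q > 0\<close> is essential.
\<close>

section \<open>Expectations and recursions\<close>

text \<open>Only the support of the mixture has to be finite: \<open>M\<close> may be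
  \<open>A\<close>, whose support can be infinite. The expectation is a finite sum over point
  masses, and each point mass of \<open>bind_pmf\<close> is a bounded average, so sum and average
  can be exchanged.\<close>

lemma expectation_bind_pmf_finite:
  fixes h :: "'b \<Rightarrow> real"
  assumes "finite (set_pmf (bind_pmf M N))"
  shows "measure_pmf.expectation (bind_pmf M N) h =
    measure_pmf.expectation M (\<lambda>x. measure_pmf.expectation (N x) h)"
proof -
  let ?B = "set_pmf (bind_pmf M N)"
  have "measure_pmf.expectation (bind_pmf M N) h = (\<Sum>b\<in>?B. h b * pmf (bind_pmf M N) b)"
    using assms by (intro integral_measure_pmf_real) auto
  also have "\<dots> = (\<Sum>b\<in>?B. measure_pmf.expectation M (\<lambda>x. h b * pmf (N x) b))"
    by (simp add: pmf_bind)
  also have "\<dots> = measure_pmf.expectation M (\<lambda>x. \<Sum>b\<in>?B. h b * pmf (N x) b)"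
    by (intro Bochner_Integration.integral_sum [symmetric] integrable_mult_right
        measure_pmf.integrable_const_bound [where B = 1]) (auto simp: pmf_le_1)
  also have "\<dots> = measure_pmf.expectation M (\<lambda>x. measure_pmf.expectation (N x) h)"
    using assms
    by (intro integral_cong_AE AE_pmfI integral_measure_pmf_real [symmetric]) auto
  finally show ?thesis .
qed

lemma expectation_mono_pmf_finite:
  fixes f g :: "'a \<Rightarrow> real"
  assumes "finite (set_pmf M)" "\<And>x. x \<in> set_pmf M \<Longrightarrow> f x \<le> g x"
  shows "measure_pmf.expectation M f \<le> measure_pmf.expectation M g"
  using assms by (intro integral_mono_AE integrable_measure_pmf_finite AE_pmfI) auto

lemma expectation_cong_pmf:
  fixes f g :: "'a \<Rightarrow> real"
  assumes "\<And>x. x \<in> set_pmf M \<Longrightarrow> f x = g x"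
  shows "measure_pmf.expectation M f = measure_pmf.expectation M g"
  using assms by (intro integral_cong_AE AE_pmfI) auto

section \<open>Scalar recursions whose coefficients decay with the network size\<close>

text \<open>Makes \<open>s powr \<kappa>\<close> an integrating factor for the recursion below. It
  combines \<open>1 - x \<le> exp (- x)\<close> with
  \<open>ln (1 + 1 / s) \<le> 1 / s\<close>.\<close>

lemma one_minus_times_powr_le:
  fixes s \<kappa> :: real
  assumes "s \<ge> 1" "\<kappa> > 0"
  shows "(1 - \<kappa> / s) * (s + 1) powr \<kappa> \<le> s powr \<kappa>"
proof -
  have "ln (s * (1 + 1 / s)) = ln s + ln (1 + 1 / s)"
    using assms by (intro ln_mult_pos) (auto intro: add_pos_pos)
  moreover have "s * (1 + 1 / s) = s + 1"
    using assms by (simp add: distrib_left)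
  ultimately have "ln (s + 1) - ln s = ln (1 + 1 / s)" by simp
  also have "\<dots> \<le> 1 / s"
    using assms by (intro ln_add_one_self_le_self) auto
  finally have "\<kappa> * (ln (s + 1) - ln s) \<le> \<kappa> * (1 / s)"
    using assms by (intro mult_left_mono) auto
  then have "- (\<kappa> / s) + \<kappa> * ln (s + 1) \<le> \<kappa> * ln s"
    by (simp add: algebra_simps)
  then have "exp (- (\<kappa> / s)) * (s + 1) powr \<kappa> \<le> s powr \<kappa>"
    using assms by (simp add: powr_def exp_add [symmetric])
  moreover have "1 - \<kappa> / s \<le> exp (- (\<kappa> / s))"
    using exp_ge_add_one_self [of "- (\<kappa> / s)"] by simp
  then have "(1 - \<kappa> / s) * (s + 1) powr \<kappa> \<le> exp (- (\<kappa> / s)) * (s + 1) powr \<kappa>"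
    by (intro mult_right_mono) auto
  ultimately show ?thesis by linarith
qed

text \<open>For every positive \<open>\<epsilon>\<close> the constant \<open>\<epsilon>\<close> is
  eventually a supersolution, since \<open>\<delta> t < \<kappa> * \<epsilon>\<close>. Hence the
  excess of \<open>x\<close> over \<open>\<epsilon>\<close> contracts by
  \<open>1 - \<kappa> / s\<close>, its product with \<open>s powr \<kappa>\<close> is eventually
  nonincreasing, and the excess decays like \<open>s powr - \<kappa>\<close>.\<close>

lemma averaging_recursion_tendsto_0:
  fixes x \<delta> :: "nat \<Rightarrow> real" and N :: nat
  assumes nonneg: "\<And>t. 0 \<le> x t" and \<kappa>: "\<kappa> > 0" and \<delta>: "\<delta> \<longlonglongrightarrow> 0"
    and step: "\<forall>\<^sub>F t in sequentially.
      x (Suc t) \<le> (1 - \<kappa> / real (N + t)) * x t + \<delta> t / real (N + t)"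
  shows "x \<longlonglongrightarrow> 0"
proof (rule LIMSEQ_I)
  fix r :: real assume r: "r > 0"
  define \<epsilon> where "\<epsilon> = r / 2"
  have \<epsilon>: "\<epsilon> > 0" using r by (simp add: \<epsilon>_def)
  define u where "u t = max 0 (x t - \<epsilon>)" for t
  define s where "s t = real (N + t)" for t
  have "\<forall>\<^sub>F t in sequentially. \<delta> t < \<kappa> * \<epsilon>"
    using order_tendstoD(2) [OF \<delta>, of "\<kappa> * \<epsilon>"] \<kappa> \<epsilon> by simp
  \<comment> \<open>\<open>s t \<ge> \<kappa>\<close> keeps the factor
    \<open>1 - \<kappa> / s t\<close> nonnegative, so inequalities may be multiplied by it.\<close>
  moreover have "\<forall>\<^sub>F t in sequentially. s t \<ge> max 1 \<kappa>"
    unfolding s_def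
    by (rule eventually_sequentiallyI [of "nat \<lceil>max 1 \<kappa>\<rceil>"]) linarith
  ultimately have "\<forall>\<^sub>F t in sequentially. s t \<ge> 1 \<and> u (Suc t) * s (Suc t) powr \<kappa> \<le> u t * s t powr \<kappa>"
    using step
  proof eventually_elim
    case (elim t)
    have s: "s t \<ge> 1" "s t \<ge> \<kappa>" using elim(2) by auto
    have "\<delta> t / s t \<le> \<kappa> * \<epsilon> / s t"
      using elim(1) s by (intro divide_right_mono) auto
    moreover have "x (Suc t) \<le> (1 - \<kappa> / s t) * x t + \<delta> t / s t"
      using elim(3) unfolding s_def .
    moreover have "(1 - \<kappa> / s t) * (x t - \<epsilon>) = (1 - \<kappa> / s t) * x t + \<kappa> * \<epsilon> / s t - \<epsilon>"
      by (simp add: algebra_simps diff_divide_distrib)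
    ultimately have "x (Suc t) - \<epsilon> \<le> (1 - \<kappa> / s t) * (x t - \<epsilon>)"
      by linarith
    also have "\<dots> \<le> (1 - \<kappa> / s t) * u t"
      using s by (intro mult_left_mono) (auto simp: u_def)
    finally have "u (Suc t) \<le> (1 - \<kappa> / s t) * u t"
      using s by (auto simp: u_def)
    then have "u (Suc t) * s (Suc t) powr \<kappa> \<le> (1 - \<kappa> / s t) * u t * (s t + 1) powr \<kappa>"
      by (intro mult_mono) (auto simp: s_def u_def add_ac)
    also have "\<dots> = u t * ((1 - \<kappa> / s t) * (s t + 1) powr \<kappa>)" by simp
    also have "\<dots> \<le> u t * s t powr \<kappa>"
      using one_minus_times_powr_le [of "s t" \<kappa>] s \<kappa> by (intro mult_left_mono) (auto simp: u_def)
    finally show ?case using s by simp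
  qed
  then obtain T where T: "\<And>t. t \<ge> T \<Longrightarrow> s t \<ge> 1"
      "\<And>t. t \<ge> T \<Longrightarrow> u (Suc t) * s (Suc t) powr \<kappa> \<le> u t * s t powr \<kappa>"
    unfolding eventually_sequentially by blast
  define C where "C = u T * s T powr \<kappa>"
  have bound: "u t * s t powr \<kappa> \<le> C" if "t \<ge> T" for t
    using that by (induction t rule: dec_induct) (use T(2) in \<open>force simp: C_def\<close>)+
  have s_top: "filterlim s at_top sequentially"
    unfolding s_def
    by (intro filterlim_compose [OF filterlim_real_sequentially] filterlim_add_const_nat_at_top
        | simp add: add.commute)+
  have "(\<lambda>t. C * s t powr - \<kappa>) \<longlonglongrightarrow> C * 0"
    using \<kappa> by (intro tendsto_intros tendsto_neg_powr s_top) auto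
  then have "\<forall>\<^sub>F t in sequentially. C * s t powr - \<kappa> < \<epsilon>"
    using \<epsilon> by (auto dest: order_tendstoD(2))
  moreover have "\<forall>\<^sub>F t in sequentially. t \<ge> T" by (rule eventually_ge_at_top)
  ultimately have "\<forall>\<^sub>F t in sequentially. norm (x t - 0) < r"
  proof eventually_elim
    case (elim t)
    have "u t \<le> C * s t powr - \<kappa>"
      using bound [OF elim(2)] T(1) [OF elim(2)] by (simp add: powr_minus field_simps)
    then have "u t < \<epsilon>" using elim(1) by simp
    then have "x t < 2 * \<epsilon>" by (simp add: u_def)
    then show ?case using nonneg [of t] by (simp add: \<epsilon>_def)
  qed
  then show "\<exists>no. \<forall>n\<ge>no. norm (x n - 0) < r"
    by (simp add: eventually_sequentially)
qed

text \<open>Dividing by the squared size turns the growth factor \<open>1 + c / s\<close> into about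
  \<open>1 - (2 - c) / s\<close>. Only half of this rate is claimed as \<open>\<kappa>\<close>,
  which leaves room for the lower-order terms.\<close>

lemma quadratic_recursion_tendsto_0:
  fixes y \<delta> :: "nat \<Rightarrow> real" and N :: nat
  assumes nonneg: "\<And>t. 0 \<le> y t" and c: "c < 2" and \<delta>: "\<delta> \<longlonglongrightarrow> 0"
    and step: "\<forall>\<^sub>F t in sequentially.
      y (Suc t) \<le> (1 + c / real (N + t)) * y t + \<delta> t * real (N + t)"
  shows "(\<lambda>t. y t / (real (N + t))\<^sup>2) \<longlonglongrightarrow> 0"
proof (rule averaging_recursion_tendsto_0 [where \<kappa> = "(2 - c) / 2" and \<delta> = "\<lambda>t. \<bar>\<delta> t\<bar>" and N = N])
  show "\<forall>\<^sub>F t in sequentially. y (Suc t) / (real (N + Suc t))\<^sup>2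
      \<le> (1 - (2 - c) / 2 / real (N + t)) * (y t / (real (N + t))\<^sup>2) + \<bar>\<delta> t\<bar> / real (N + t)"
    using step eventually_ge_at_top [of "3 :: nat"]
  proof eventually_elim
    case (elim t)
    define s where "s = real (N + t)"
    define \<kappa> where "\<kappa> = (2 - c) / 2"
    have s: "s \<ge> 3" using elim(2) by (simp add: s_def)
    have \<kappa>: "\<kappa> > 0" using c by (simp add: \<kappa>_def)
    \<comment> \<open>The right-hand side is
      \<open>(s - \<kappa>) * (s + 1)\<^sup>2 - s\<^sup>2 * (s + c)\<close> with
      \<open>c = 2 - 2 * \<kappa>\<close> substituted; \<open>s \<ge> 3\<close> makes each of its
      summands nonnegative.\<close>
    have "0 \<le> \<kappa> * (s * (s - 3) + (s - 1)) + s"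
      using s \<kappa> by (intro add_nonneg_nonneg mult_nonneg_nonneg) auto
    then have "s\<^sup>2 * (s + c) \<le> (s - \<kappa>) * (s + 1)\<^sup>2"
      by (simp add: \<kappa>_def field_simps power2_eq_square)
    then have "s * (s + c) * s \<le> (s - \<kappa>) * (s + 1)\<^sup>2"
      by (simp add: power2_eq_square mult_ac)
    then have "s * (s + c) / (s + 1)\<^sup>2 \<le> (s - \<kappa>) / s"
      using s by (simp add: pos_divide_le_eq pos_le_divide_eq)
    then have "s * (s + c) / (s + 1)\<^sup>2 \<le> 1 - \<kappa> / s"
      using s by (simp add: diff_divide_distrib)
    then have "s * (s + c) / (s + 1)\<^sup>2 * (y t / s\<^sup>2) \<le> (1 - \<kappa> / s) * (y t / s\<^sup>2)"
      using nonneg [of t] by (intro mult_right_mono) auto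
    moreover have "s * (s + c) / (s + 1)\<^sup>2 * (y t / s\<^sup>2) = (1 + c / s) * y t / (s + 1)\<^sup>2"
      using s by (simp add: divide_simps power2_eq_square)
    moreover have "\<delta> t * s / (s + 1)\<^sup>2 \<le> \<bar>\<delta> t\<bar> / s"
    proof -
      have "\<delta> t * s / (s + 1)\<^sup>2 \<le> \<bar>\<delta> t\<bar> * s / s\<^sup>2"
        using s by (intro frac_le mult_right_mono power_mono) auto
      also have "\<dots> = \<bar>\<delta> t\<bar> / s" using s by (simp add: power2_eq_square)
      finally show ?thesis .
    qed
    moreover have "y (Suc t) / (s + 1)\<^sup>2 \<le> ((1 + c / s) * y t + \<delta> t * s) / (s + 1)\<^sup>2"
      using elim(1) by (intro divide_right_mono) (auto simp: s_def)
    ultimately show ?case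
      by (simp add: s_def [symmetric] \<kappa>_def [symmetric] add_divide_distrib) (simp add: s_def add_ac)
  qed
qed (use assms tendsto_rabs_zero in auto)

text \<open>The limit is the fixed point of the recursion for the ratio of \<open>y\<close> to the
  size. The distance to it obeys the averaging recursion with rate \<open>1 + c\<close>: the outflow
  contributes \<open>c\<close> and the growing denominator contributes 1.\<close>

lemma linear_recursion_tendsto:
  fixes y b :: "nat \<Rightarrow> real" and N :: nat
  assumes N: "N > 0" and c: "0 \<le> c" and b: "b \<longlonglongrightarrow> \<beta>"
    and step: "\<And>t. y (Suc t) = y t + b t - c * (y t / real (N + t))"
  shows "(\<lambda>t. y t / real (N + t)) \<longlonglongrightarrow> \<beta> / (1 + c)"
proof -
  define L where "L = \<beta> / (1 + c)"
  define x where "x t = y t / real (N + t)" for t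
  have \<beta>: "\<beta> = (1 + c) * L" using c by (simp add: L_def)
  have "(\<lambda>t. \<bar>x t - L\<bar>) \<longlonglongrightarrow> 0"
  \<comment> \<open>The ratio at the next time has the size after the step as denominator, hence
    \<open>Suc N\<close>.\<close>
  proof (rule averaging_recursion_tendsto_0 [where \<kappa> = "1 + c" and \<delta> = "\<lambda>t. \<bar>b t - \<beta>\<bar>" and N = "Suc N"])
    show "(\<lambda>t. \<bar>b t - \<beta>\<bar>) \<longlonglongrightarrow> 0"
      using b by (simp add: LIM_zero tendsto_rabs_zero)
    have "\<forall>\<^sub>F t in sequentially. real (Suc N + t) \<ge> 1 + c"
      by (rule eventually_sequentiallyI [of "nat \<lceil>1 + c\<rceil>"]) linarith
    then show "\<forall>\<^sub>F t in sequentially. \<bar>x (Suc t) - L\<bar>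
      \<le> (1 - (1 + c) / real (Suc N + t)) * \<bar>x t - L\<bar> + \<bar>b t - \<beta>\<bar> / real (Suc N + t)"
    proof eventually_elim
      case (elim t)
      define s where "s = real (N + t)"
      have s: "s > 0" using N by (simp add: s_def)
      have y: "y t = s * x t" unfolding x_def s_def using N by auto
      have x': "x (Suc t) = (s * x t + b t - c * x t) / (s + 1)"
        unfolding x_def step using N by (simp add: s_def add_ac)
      have "x (Suc t) - L = (1 - (1 + c) / (s + 1)) * (x t - L) + (b t - \<beta>) / (s + 1)"
        unfolding x' \<beta> using s by (simp add: divide_simps) (simp add: algebra_simps)
      then have "\<bar>x (Suc t) - L\<bar> \<le> \<bar>(1 - (1 + c) / (s + 1)) * (x t - L)\<bar> + \<bar>(b t - \<beta>) / (s + 1)\<bar>"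
        by (simp only: abs_triangle_ineq)
      also have "\<dots> = (1 - (1 + c) / (s + 1)) * \<bar>x t - L\<bar> + \<bar>b t - \<beta>\<bar> / (s + 1)"
        using elim s by (simp add: abs_mult s_def)
      finally show ?case by (simp add: s_def add_ac)
    qed
  qed (use c in auto)
  then show ?thesis
    unfolding x_def L_def [symmetric] by (simp add: LIM_zero_iff tendsto_rabs_zero_iff)
qed

section \<open>Selection without replacement\<close>

text \<open>Chebyshev's sum inequality. The sum over all pairs of
  \<open>x u * x v * ((g u - g v) * (f u - f v))\<close> is nonnegative and expands to twice the
  difference of the two sides.\<close>

lemma chebyshev_weighted:
  fixes x f g :: "'a \<Rightarrow> real"
  assumes "finite U" and nonneg: "\<And>v. v \<in> U \<Longrightarrow> 0 \<le> x v" and sum1: "(\<Sum>v\<in>U. x v) = 1"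
    and mono: "\<And>u v. u \<in> U \<Longrightarrow> v \<in> U \<Longrightarrow> 0 \<le> (g u - g v) * (f u - f v)"
  shows "(\<Sum>v\<in>U. x v * g v) * (\<Sum>v\<in>U. x v * f v) \<le> (\<Sum>v\<in>U. x v * g v * f v)"
proof -
  have "0 \<le> (\<Sum>u\<in>U. \<Sum>v\<in>U. x u * x v * ((g u - g v) * (f u - f v)))"
    by (intro sum_nonneg mult_nonneg_nonneg nonneg mono)
  also have "\<dots> = (\<Sum>u\<in>U. \<Sum>v\<in>U. x v * (x u * g u * f u)) + (\<Sum>u\<in>U. \<Sum>v\<in>U. x u * (x v * g v * f v))
      - (\<Sum>u\<in>U. \<Sum>v\<in>U. (x u * g u) * (x v * f v)) - (\<Sum>u\<in>U. \<Sum>v\<in>U. (x u * f u) * (x v * g v))"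
    unfolding sum.distrib [symmetric] sum_subtractf [symmetric]
    by (intro sum.cong refl) (simp add: algebra_simps)
  also have "\<dots> = 2 * ((\<Sum>v\<in>U. x v * g v * f v) - (\<Sum>v\<in>U. x v * g v) * (\<Sum>v\<in>U. x v * f v))"
    by (simp only: sum_distrib_right [symmetric] sum_distrib_left [symmetric] sum1) simp
  finally show ?thesis by simp
qed

text \<open>With normalized weights \<open>x\<close> and mean \<open>T\<close>, removing
  \<open>v\<close> changes the mean to \<open>T + x v * (T - f v) / (1 - x v)\<close>. The average
  change is the sum of \<open>x v * g v * (T - f v)\<close> with
  \<open>g v = x v / (1 - x v)\<close>; since \<open>g\<close> and \<open>f\<close> are ordered
  alike, Chebyshev's inequality makes it nonpositive.\<close>

lemma size_biased_removal_le:
  fixes w f :: "'a \<Rightarrow> real"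
  assumes "finite U" and w: "\<And>v. v \<in> U \<Longrightarrow> 0 \<le> w v" and f: "\<And>v. v \<in> U \<Longrightarrow> 0 \<le> f v"
    and W: "(\<Sum>v\<in>U. w v) > 0"
    and mono: "\<And>u v. u \<in> U \<Longrightarrow> v \<in> U \<Longrightarrow> f u \<le> f v \<Longrightarrow> w u \<le> w v"
  shows "(\<Sum>v\<in>U. w v / (\<Sum>u\<in>U. w u) * ((\<Sum>u\<in>U - {v}. w u * f u) / (\<Sum>u\<in>U - {v}. w u)))
    \<le> (\<Sum>u\<in>U. w u * f u) / (\<Sum>u\<in>U. w u)"
proof -
  define W where "W = (\<Sum>u\<in>U. w u)"
  define x where "x v = w v / W" for v
  define T where "T = (\<Sum>v\<in>U. x v * f v)"
  have W_pos: "W > 0" using W by (simp add: W_def)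
  have x: "0 \<le> x v" if "v \<in> U" for v
    using w [OF that] W_pos by (simp add: x_def)
  have x_sum: "(\<Sum>v\<in>U. x v) = 1"
    using W_pos by (simp add: x_def sum_divide_distrib [symmetric] W_def)
  have T: "T = (\<Sum>u\<in>U. w u * f u) / W"
    by (simp add: T_def x_def sum_divide_distrib)
  have "0 \<le> T" unfolding T_def by (intro sum_nonneg mult_nonneg_nonneg x f)
  have quot: "(\<Sum>u\<in>U - {v}. w u * f u) / (\<Sum>u\<in>U - {v}. w u) = (T - x v * f v) / (1 - x v)"
    if "v \<in> U" for v
  proof -
    have "(\<Sum>u\<in>U - {v}. w u * f u) = W * (T - x v * f v)"
      using that \<open>finite U\<close> W_pos by (simp add: sum_diff1 T x_def field_simps)
    moreover have "(\<Sum>u\<in>U - {v}. w u) = W * (1 - x v)"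
      using that \<open>finite U\<close> W_pos by (simp add: sum_diff1 W_def [symmetric] x_def field_simps)
    ultimately show ?thesis using W_pos by simp
  qed
  have "(\<Sum>v\<in>U. x v * ((T - x v * f v) / (1 - x v))) \<le> T"
  proof (cases "\<exists>v\<in>U. x v = 1")
    \<comment> \<open>A node of full weight leaves nothing to draw from afterwards. Every summand is
      then 0, either by a zero weight or by division by 0.\<close>
    case True
    then obtain v where v: "v \<in> U" "x v = 1" by blast
    have "(\<Sum>u\<in>U - {v}. x u) = 0"
      using v \<open>finite U\<close> x_sum by (simp add: sum_diff1)
    then have "\<forall>u\<in>U - {v}. x u = 0"
      using \<open>finite U\<close> x by (subst (asm) sum_nonneg_eq_0_iff) auto
    then have "(\<Sum>u\<in>U. x u * ((T - x u * f u) / (1 - x u))) = 0"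
      using v by (intro sum.neutral) auto
    then show ?thesis using \<open>0 \<le> T\<close> by simp
  next
    case False
    have less1: "x v < 1" if "v \<in> U" for v
    proof -
      have "x v \<le> (\<Sum>v\<in>U. x v)"
        using that \<open>finite U\<close> x by (intro member_le_sum) auto
      then show ?thesis using False that x_sum by fastforce
    qed
    define g where "g v = x v / (1 - x v)" for v
    have g_mono: "g u \<le> g v" if "x u \<le> x v" "x v < 1" for u v
    proof -
      have "g u = 1 / (1 - x u) - 1" "g v = 1 / (1 - x v) - 1"
        using that by (simp_all add: g_def field_simps)
      moreover have "1 / (1 - x u) \<le> 1 / (1 - x v)"
        using that by (intro divide_left_mono) auto
      ultimately show ?thesis by simp
    qed
    have x_mono: "x u \<le> x v" if "u \<in> U" "v \<in> U" "f u \<le> f v" for u v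
      using mono [OF that] W_pos by (simp add: x_def divide_right_mono)
    have "(\<Sum>v\<in>U. x v * g v) * (\<Sum>v\<in>U. x v * f v) \<le> (\<Sum>v\<in>U. x v * g v * f v)"
    proof (rule chebyshev_weighted [OF \<open>finite U\<close> x x_sum])
      fix u v assume uv: "u \<in> U" "v \<in> U"
      show "0 \<le> (g u - g v) * (f u - f v)"
      proof (cases "f u \<le> f v")
        case True
        then show ?thesis
          using g_mono [OF x_mono [OF uv True] less1 [OF uv(2)]] by (simp add: mult_nonpos_nonpos)
      next
        case False
        then have "f v \<le> f u" by simp
        then show ?thesis
          using g_mono [OF x_mono [OF uv(2,1)] less1 [OF uv(1)]] by simp
      qed
    qed
    moreover have "(\<Sum>v\<in>U. x v * ((T - x v * f v) / (1 - x v)))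
      = (\<Sum>v\<in>U. x v) * T + ((\<Sum>v\<in>U. x v * g v) * T - (\<Sum>v\<in>U. x v * g v * f v))"
    proof -
      have "x v * ((T - x v * f v) / (1 - x v)) = x v * T + (x v * g v * T - x v * g v * f v)"
        if "v \<in> U" for v
      proof -
        have "T - x v * f v = T * (1 - x v) + x v * (T - f v)" by (simp add: algebra_simps)
        then have "(T - x v * f v) / (1 - x v) = T + x v * (T - f v) / (1 - x v)"
          using less1 [OF that] by (simp add: add_divide_distrib)
        then show ?thesis by (simp add: g_def algebra_simps diff_divide_distrib)
      qed
      then show ?thesis
        by (simp add: sum.distrib sum_subtractf sum_distrib_right)
    qed
    ultimately show ?thesis by (simp add: x_sum T_def)
  qed
  moreover have "(\<Sum>v\<in>U. w v / W * ((\<Sum>u\<in>U - {v}. w u * f u) / (\<Sum>u\<in>U - {v}. w u)))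
      = (\<Sum>v\<in>U. x v * ((T - x v * f v) / (1 - x v)))"
    by (intro sum.cong refl) (simp add: quot x_def)
  ultimately show ?thesis unfolding W_def [symmetric] T by simp
qed

section \<open>Draws from the attachment distribution of a fixed network\<close>

locale growth_step =
  fixes p q :: real and G :: network
  assumes digraph: "pair_fin_digraph G" and nonempty: "pverts G \<noteq> {}"
    and p: "0 \<le> p" "p \<le> 1" and q: "0 < q" "q \<le> 1"
begin

abbreviation "V \<equiv> pverts G"
abbreviation "nodes \<equiv> card (pverts G)"
abbreviation "deg v \<equiv> real (in_degree G v)"
abbreviation "edges \<equiv> real (total_in_degree G)"
abbreviation "w v \<equiv> pmf (attach_pmf p G) v"

lemma finite_V [simp]: "finite V"
  using digraph by (rule pair_fin_digraph.pair_finite_verts)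

lemma nodes_pos: "nodes > 0"
  using nonempty by (simp add: card_gt_0_iff)

lemma edges_eq: "edges = (\<Sum>v\<in>V. deg v)"
  by (simp add: total_in_degree_def)

lemma w_uniform: "edges = 0 \<Longrightarrow> v \<in> V \<Longrightarrow> w v = 1 / nodes"
  using nonempty by (simp add: attach_pmf_def)

lemma w_mixed: "edges \<noteq> 0 \<Longrightarrow> v \<in> V \<Longrightarrow> w v = p * (deg v / edges) + (1 - p) / nodes"
  using pmf_attach_pmf [OF digraph _ p] by (simp add: attach_prob_def)

lemma w_outside: "v \<notin> V \<Longrightarrow> w v = 0"
  using pmf_attach_pmf [OF digraph _ p] nonempty
  by (cases "total_in_degree G = 0") (auto simp: attach_pmf_def)

lemma set_attach_subset: "set_pmf (attach_pmf p G) \<subseteq> V"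
  using w_outside by (metis set_pmf_iff subsetI)

lemma sum_w: "(\<Sum>v\<in>V. w v) = 1"
  using set_attach_subset by (simp add: sum_pmf_eq_1)

lemma deg_0: "edges = 0 \<Longrightarrow> v \<in> V \<Longrightarrow> deg v = 0"
  by (simp add: total_in_degree_def del: of_nat_sum)

lemma w_mono:
  assumes "u \<in> V" "v \<in> V" "deg u \<le> deg v"
  shows "w u \<le> w v"
proof (cases "edges = 0")
  case True
  then show ?thesis using assms by (simp add: w_uniform)
next
  case False
  then show ?thesis
    using assms p by (auto simp: w_mixed intro!: mult_left_mono divide_right_mono)
qed

text \<open>In a network with edges, both nonnegative terms of the mixture must vanish, which leaves
  only \<open>p = 1\<close> and in-degree 0. This is the second clause of \<open>aligned\<close> for
  the in-degree.\<close>

lemma deg_0_if_w_0: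
  assumes "v \<in> V" "w v = 0"
  shows "deg v = 0"
proof (cases "edges = 0")
  case True
  then show ?thesis using assms deg_0 by simp
next
  case False
  then have "p * (deg v / edges) + (1 - p) / nodes = 0"
    using assms w_mixed by simp
  moreover have "0 \<le> p * (deg v / edges)" "0 \<le> (1 - p) / nodes" using p by auto
  ultimately have "p * (deg v / edges) = 0" "(1 - p) / nodes = 0" by linarith+
  then show ?thesis using False nodes_pos by auto
qed

text \<open>
  Aligned functions are those whose expected value at the successive draws without replacement does
  not increase.  The junk value 0 of the quotient in \<open>expectation_draw_new_aligned\<close> is correct when
  the attractive nodes are exhausted, because aligned functions vanish on the others.
\<close>

definition aligned :: "(nat \<Rightarrow> real) \<Rightarrow> bool" where
  "aligned f \<longleftrightarrow> (\<forall>u\<in>V. \<forall>v\<in>V. f u \<le> f v \<longrightarrow> w u \<le> w v) \<and> (\<forall>v\<in>V. 0 \<le> f v \<and> (w v = 0 \<longrightarrow> f v = 0))"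

text \<open>Two aligned functions are used: the in-degree controls the growth of the sum of squares,
  and the weight \<open>w\<close> controls the mass removed by earlier draws.\<close>

lemma aligned_deg: "aligned (\<lambda>v. deg v)"
  using w_mono deg_0_if_w_0 by (auto simp: aligned_def)

lemma aligned_w: "aligned (\<lambda>v. w v)"
  by (auto simp: aligned_def)

lemma set_draw_new:
  assumes "S \<subset> V"
  shows "set_pmf (draw_new p G S) \<subseteq> V - S"
proof -
  have "finite (V - S)" "V - S \<noteq> {}" using assms by auto
  moreover have "set_pmf (cond_pmf (attach_pmf p G) (- S)) \<subseteq> V - S"
    if "\<not> set_pmf (attach_pmf p G) \<subseteq> S"
  proof -
    have "set_pmf (attach_pmf p G) \<inter> - S \<noteq> {}" using that by blast
    then show ?thesis using set_attach_subset by (auto simp: set_cond_pmf)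
  qed
  ultimately show ?thesis by (simp add: draw_new_def)
qed

lemma expectation_draw_new:
  assumes S: "S \<subset> V" and "\<not> set_pmf (attach_pmf p G) \<subseteq> S"
  shows "(\<Sum>v\<in>V - S. w v) > 0"
    and "measure_pmf.expectation (draw_new p G S) f = (\<Sum>v\<in>V - S. w v * f v) / (\<Sum>v\<in>V - S. w v)"
proof -
  have ne: "set_pmf (attach_pmf p G) \<inter> - S \<noteq> {}" using assms by blast
  then obtain u where u: "u \<in> V - S" "w u > 0"
    using set_attach_subset pmf_positive by fastforce
  then show "(\<Sum>v\<in>V - S. w v) > 0"
    by (intro sum_pos2 [of _ u]) auto
  have "measure_pmf.prob (attach_pmf p G) (- S) = measure_pmf.prob (attach_pmf p G) (V - S)"
    using set_attach_subset by (intro measure_pmf.finite_measure_eq_AE AE_pmfI) auto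
  then have prob: "measure_pmf.prob (attach_pmf p G) (- S) = (\<Sum>v\<in>V - S. w v)"
    by (simp add: measure_measure_pmf_finite)
  have "measure_pmf.expectation (draw_new p G S) f = (\<Sum>v\<in>V - S. f v * pmf (draw_new p G S) v)"
    using set_draw_new [OF S] by (intro integral_measure_pmf_real) auto
  also have "\<dots> = (\<Sum>v\<in>V - S. w v * f v / (\<Sum>v\<in>V - S. w v))"
    using assms ne by (intro sum.cong refl) (simp add: draw_new_def pmf_cond prob)
  finally show "measure_pmf.expectation (draw_new p G S) f
      = (\<Sum>v\<in>V - S. w v * f v) / (\<Sum>v\<in>V - S. w v)"
    by (simp add: sum_divide_distrib)
qed

lemma w_zero_if_exhausted: "set_pmf (attach_pmf p G) \<subseteq> S \<Longrightarrow> v \<in> V - S \<Longrightarrow> w v = 0"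
  by (auto simp: set_pmf_iff)

lemma expectation_draw_new_aligned:
  assumes S: "S \<subset> V" and f: "aligned f"
  shows "measure_pmf.expectation (draw_new p G S) f = (\<Sum>v\<in>V - S. w v * f v) / (\<Sum>v\<in>V - S. w v)"
proof (cases "set_pmf (attach_pmf p G) \<subseteq> S")
  case True
  have "f v = 0" if "v \<in> set_pmf (draw_new p G S)" for v
    using w_zero_if_exhausted [OF True, of v] f set_draw_new [OF S] that by (auto simp: aligned_def)
  then have "measure_pmf.expectation (draw_new p G S) f = 0"
    using expectation_cong_pmf [of "draw_new p G S" f "\<lambda>_. 0"] by simp
  then show ?thesis using w_zero_if_exhausted [OF True] by simp
qed (use expectation_draw_new [OF S] in simp)

text \<open>This is \<open>size_biased_removal_le\<close> on the remaining nodes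
  \<open>V - S\<close>. The bound on \<open>card S\<close> guarantees that a node is left for the
  second draw; if only nodes of weight 0 remain, both sides are 0.\<close>

lemma expectation_next_draw_le:
  assumes S: "S \<subseteq> V" "Suc (card S) < nodes" and f: "aligned f"
  shows "measure_pmf.expectation (draw_new p G S)
      (\<lambda>v. measure_pmf.expectation (draw_new p G (insert v S)) f)
    \<le> measure_pmf.expectation (draw_new p G S) f"
proof -
  have S': "S \<subset> V" using S by auto
  have next_draw: "measure_pmf.expectation (draw_new p G (insert v S)) f
      = (\<Sum>u\<in>V - S - {v}. w u * f u) / (\<Sum>u\<in>V - S - {v}. w u)" if "v \<in> V - S" for v
  proof -
    have "card (insert v S) < nodes"
      using S that finite_subset [OF S(1)] by simp
    then have "insert v S \<noteq> V" by auto
    then have "insert v S \<subset> V" using S(1) that by blast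
    then show ?thesis
      using expectation_draw_new_aligned [OF _ f, of "insert v S"]
      by (simp add: Diff_insert [of V v S])
  qed
  have draws: "v \<in> set_pmf (draw_new p G S) \<Longrightarrow> v \<in> V - S" for v
    using set_draw_new [OF S'] by blast
  show ?thesis
  proof (cases "set_pmf (attach_pmf p G) \<subseteq> S")
    case True
    have "measure_pmf.expectation (draw_new p G S)
        (\<lambda>v. measure_pmf.expectation (draw_new p G (insert v S)) f)
      = measure_pmf.expectation (draw_new p G S) (\<lambda>v. 0)"
    proof (rule expectation_cong_pmf)
      fix v assume "v \<in> set_pmf (draw_new p G S)"
      then show "measure_pmf.expectation (draw_new p G (insert v S)) f = 0"
        using next_draw [OF draws] w_zero_if_exhausted [OF True] by simp
    qed
    then show ?thesis
      using True by (simp add: expectation_draw_new_aligned [OF S' f] w_zero_if_exhausted)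
  next
    case False
    have "(\<Sum>v\<in>V - S. w v * ((\<Sum>u\<in>V - S - {v}. w u * f u) / (\<Sum>u\<in>V - S - {v}. w u))) / (\<Sum>v\<in>V - S. w v)
        \<le> (\<Sum>v\<in>V - S. w v * f v) / (\<Sum>v\<in>V - S. w v)"
      using size_biased_removal_le [of "V - S" "\<lambda>v. w v" f] f expectation_draw_new(1) [OF S' False]
      by (simp add: aligned_def sum_divide_distrib)
    then show ?thesis
      by (simp add: expectation_draw_new(2) [OF S' False] next_draw)
  qed
qed

lemma set_select: "m \<le> nodes \<Longrightarrow> S \<in> set_pmf (select p G m) \<Longrightarrow> S \<subseteq> V \<and> card S = m"
proof (induction m arbitrary: S)
  case (Suc m)
  then obtain T v where T: "T \<in> set_pmf (select p G m)" "v \<in> set_pmf (draw_new p G T)" "S = insert v T"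
    by auto
  have TV: "T \<subseteq> V" "card T = m" using Suc.IH [OF _ T(1)] Suc.prems by auto
  then have "T \<subset> V" using Suc.prems by auto
  then have "v \<in> V - T" using set_draw_new T(2) by blast
  then show ?case using T(3) TV finite_subset [OF TV(1)] by auto
qed auto

lemma finite_set_select: "m \<le> nodes \<Longrightarrow> finite (set_pmf (select p G m))"
  by (rule finite_subset [of _ "Pow V"]) (use set_select in auto)

lemma expectation_select_Suc:
  fixes h :: "nat set \<Rightarrow> real"
  assumes "m < nodes"
  shows "measure_pmf.expectation (select p G (Suc m)) h = measure_pmf.expectation (select p G m)
      (\<lambda>S. measure_pmf.expectation (draw_new p G S) (\<lambda>v. h (insert v S)))"
proof -
  have "finite (set_pmf (select p G (Suc m)))"
    using assms by (intro finite_set_select) simp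
  then show ?thesis
    by (simp add: expectation_bind_pmf_finite)
qed

text \<open>Iterating the comparison of consecutive draws leads back to the first draw, whose law is
  \<open>w\<close> itself.\<close>

lemma expectation_draw_after_select_le:
  assumes f: "aligned f" and "m < nodes"
  shows "measure_pmf.expectation (select p G m) (\<lambda>S. measure_pmf.expectation (draw_new p G S) f)
    \<le> (\<Sum>v\<in>V. w v * f v)"
  using \<open>m < nodes\<close>
proof (induction m)
  case 0
  have "{} \<subset> V" using nonempty by auto
  then show ?case
    using expectation_draw_new_aligned [OF _ f, of "{}"] by (simp add: sum_w)
next
  case (Suc m)
  have "measure_pmf.expectation (select p G (Suc m)) (\<lambda>S. measure_pmf.expectation (draw_new p G S) f)
    \<le> measure_pmf.expectation (select p G m) (\<lambda>S. measure_pmf.expectation (draw_new p G S) f)"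
    unfolding expectation_select_Suc [OF Suc_lessD [OF Suc.prems]]
    using Suc.prems set_select [of m]
    by (intro expectation_mono_pmf_finite finite_set_select expectation_next_draw_le f) auto
  also have "\<dots> \<le> (\<Sum>v\<in>V. w v * f v)" using Suc by simp
  finally show ?case .
qed

lemma expectation_sum_Suc:
  fixes f :: "nat \<Rightarrow> real"
  assumes "m < nodes"
  shows "measure_pmf.expectation (select p G (Suc m)) (\<lambda>S. \<Sum>v\<in>S. f v)
    = measure_pmf.expectation (select p G m) (\<lambda>S. \<Sum>v\<in>S. f v)
    + measure_pmf.expectation (select p G m) (\<lambda>S. measure_pmf.expectation (draw_new p G S) f)"
proof -
  have "measure_pmf.expectation (select p G (Suc m)) (\<lambda>S. \<Sum>v\<in>S. f v)
    = measure_pmf.expectation (select p G m)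
        (\<lambda>S. (\<Sum>v\<in>S. f v) + measure_pmf.expectation (draw_new p G S) f)"
    unfolding expectation_select_Suc [OF assms]
  proof (rule expectation_cong_pmf)
    fix S assume "S \<in> set_pmf (select p G m)"
    then have S: "S \<subseteq> V" "card S = m" using set_select [of m S] assms by auto
    then have S': "S \<subset> V" using assms by auto
    have fin: "finite S" using S finite_V finite_subset by blast
    have fin': "finite (set_pmf (draw_new p G S))"
      by (rule finite_subset [OF set_draw_new [OF S']]) simp
    have "measure_pmf.expectation (draw_new p G S) (\<lambda>v. \<Sum>u\<in>insert v S. f u)
      = measure_pmf.expectation (draw_new p G S) (\<lambda>v. (\<Sum>u\<in>S. f u) + f v)"
      using set_draw_new [OF S'] fin by (intro expectation_cong_pmf) (auto simp: add.commute)
    then show "measure_pmf.expectation (draw_new p G S) (\<lambda>v. \<Sum>u\<in>insert v S. f u)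
      = (\<Sum>u\<in>S. f u) + measure_pmf.expectation (draw_new p G S) f"
      using fin' by (simp add: integrable_measure_pmf_finite)
  qed
  then show ?thesis
    using assms by (simp add: integrable_measure_pmf_finite finite_set_select)
qed

lemma expectation_select_sum_le:
  assumes f: "aligned f" and "m \<le> nodes"
  shows "measure_pmf.expectation (select p G m) (\<lambda>S. \<Sum>v\<in>S. f v) \<le> m * (\<Sum>v\<in>V. w v * f v)"
  using \<open>m \<le> nodes\<close>
proof (induction m)
  case (Suc m)
  then show ?case
    using expectation_sum_Suc [of m f] expectation_draw_after_select_le [OF f, of m]
    by (simp add: algebra_simps del: select.simps)
qed simp

text \<open>Drawing without replacement differs from independent draws only through the mass already drawn.\<close>

lemma draw_new_mass:
  assumes S: "S \<subset> V" and D: "D \<subseteq> V"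
  shows "\<bar>measure_pmf.expectation (draw_new p G S) (indicator D) - (\<Sum>v\<in>D. w v)\<bar> \<le> 2 * (\<Sum>v\<in>S. w v)"
proof -
  define s where "s = (\<Sum>v\<in>S. w v)"
  define d where "d = (\<Sum>v\<in>D. w v)"
  define ds where "ds = (\<Sum>v\<in>D \<inter> S. w v)"
  define E where "E = measure_pmf.expectation (draw_new p G S) (indicator D :: nat \<Rightarrow> real)"
  have fin: "finite S" "finite D" using S D finite_subset finite_V by blast+
  have s: "0 \<le> s" "s \<le> 1"
    using S sum_w sum_mono2 [of V S "\<lambda>v. w v"] by (auto simp: s_def sum_nonneg)
  have d: "0 \<le> d" "d \<le> 1"
    using D sum_w sum_mono2 [of V D "\<lambda>v. w v"] by (auto simp: d_def sum_nonneg)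
  have ds: "0 \<le> ds" "ds \<le> s"
    using fin sum_mono2 [of S "D \<inter> S" "\<lambda>v. w v"] by (auto simp: ds_def s_def sum_nonneg)
  have E: "0 \<le> E" "E \<le> 1"
    by (auto simp: E_def integral_nonneg)
  have rest: "(\<Sum>v\<in>V - S. w v) = 1 - s"
    using S by (subst sum_diff) (auto simp: sum_w s_def)
  \<comment> \<open>If at most half of the mass is gone, the normalization \<open>1 - s\<close> is
    at least 1/2. Otherwise \<open>2 * s\<close> exceeds 1 and bounds any difference of two
    probabilities; this also covers the uniform fallback of \<open>draw_new\<close>.\<close>
  show ?thesis
  proof (cases "s \<le> 1 / 2")
    case True
    then have "\<not> set_pmf (attach_pmf p G) \<subseteq> S"
      using w_zero_if_exhausted rest by fastforce
    then have "E = (\<Sum>v\<in>V - S. w v * indicator D v) / (1 - s)"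
      unfolding E_def rest [symmetric] by (rule expectation_draw_new(2) [OF S])
    also have "(\<Sum>v\<in>V - S. w v * indicator D v) = (\<Sum>v\<in>D - D \<inter> S. w v)"
      using D by (intro sum.mono_neutral_cong_right) (auto simp: indicator_def)
    also have "\<dots> = d - ds"
      using fin by (subst sum_diff) (auto simp: d_def ds_def)
    finally have "E - d = (d * s - ds) / (1 - s)"
      using True by (simp add: field_simps)
    then have "\<bar>E - d\<bar> = \<bar>d * s - ds\<bar> / (1 - s)"
      using True by simp
    also have "\<dots> \<le> s / (1 / 2)"
    proof (rule frac_le)
      have "0 \<le> d * s" "d * s \<le> s"
        using d s by (auto intro: mult_left_le_one_le)
      then show "\<bar>d * s - ds\<bar> \<le> s" using ds by linarith
    qed (use True s in auto)
    finally show ?thesis by (simp add: E_def d_def s_def)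
  next
    case False
    then have "\<bar>E - d\<bar> \<le> 2 * s" using d E by linarith
    then show ?thesis by (simp add: E_def d_def s_def)
  qed
qed

text \<open>After \<open>i\<close> draws the next one errs by at most twice the expected mass
  already drawn, which is at most \<open>i\<close> times the sum of squared weights because
  \<open>w\<close> is aligned. Summing \<open>2 * i\<close> over \<open>i < m\<close> gives
  \<open>m * (m - 1)\<close>.\<close>

lemma expectation_select_card:
  assumes D: "D \<subseteq> V" and "m \<le> nodes"
  shows "\<bar>measure_pmf.expectation (select p G m) (\<lambda>S. real (card (S \<inter> D))) - m * (\<Sum>v\<in>D. w v)\<bar>
    \<le> real m * (real m - 1) * (\<Sum>v\<in>V. (w v)\<^sup>2)"
  using \<open>m \<le> nodes\<close>
proof (induction m)
  case (Suc m)
  define \<sigma> where "\<sigma> = (\<Sum>v\<in>V. (w v)\<^sup>2)"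
  define E where "E m = measure_pmf.expectation (select p G m) (\<lambda>S. \<Sum>v\<in>S. indicator D v :: real)" for m
  have E: "measure_pmf.expectation (select p G m) (\<lambda>S. real (card (S \<inter> D))) = E m" if "m \<le> nodes" for m
    unfolding E_def
  proof (rule expectation_cong_pmf)
    fix S assume "S \<in> set_pmf (select p G m)"
    then have "finite S" using set_select that finite_V finite_subset by blast
    then show "real (card (S \<inter> D)) = (\<Sum>v\<in>S. indicator D v)"
      by (simp add: card_eq_sum sum.inter_restrict indicator_def of_bool_def
          if_distrib [of real] del: sum_constant cong: if_cong)
  qed
  define X where "X = measure_pmf.expectation (select p G m)
    (\<lambda>S. measure_pmf.expectation (draw_new p G S) (indicator D :: nat \<Rightarrow> real))"
  have fin: "finite (set_pmf (select p G m))" using Suc.prems by (simp add: finite_set_select)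
  have "X - (\<Sum>v\<in>D. w v) = measure_pmf.expectation (select p G m)
    (\<lambda>S. measure_pmf.expectation (draw_new p G S) (indicator D) - (\<Sum>v\<in>D. w v))"
    using fin by (simp add: X_def integrable_measure_pmf_finite)
  then have "\<bar>X - (\<Sum>v\<in>D. w v)\<bar> \<le> measure_pmf.expectation (select p G m)
    (\<lambda>S. \<bar>measure_pmf.expectation (draw_new p G S) (indicator D) - (\<Sum>v\<in>D. w v)\<bar>)"
    by simp
  also have "\<dots> \<le> measure_pmf.expectation (select p G m) (\<lambda>S. 2 * (\<Sum>v\<in>S. w v))"
    using Suc.prems set_select [of m]
    by (intro expectation_mono_pmf_finite fin draw_new_mass D) fastforce+
  also have "\<dots> = 2 * measure_pmf.expectation (select p G m) (\<lambda>S. \<Sum>v\<in>S. w v)"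
    using fin by (simp add: integrable_measure_pmf_finite)
  also have "\<dots> \<le> 2 * (m * \<sigma>)"
    using expectation_select_sum_le [OF aligned_w, of m] Suc.prems
    by (simp add: \<sigma>_def power2_eq_square)
  finally have "\<bar>X - (\<Sum>v\<in>D. w v)\<bar> \<le> 2 * m * \<sigma>" by simp
  moreover have "E (Suc m) = E m + X"
    using expectation_sum_Suc [of m "indicator D"] Suc.prems by (simp add: E_def X_def del: select.simps)
  moreover have "\<bar>E m - m * (\<Sum>v\<in>D. w v)\<bar> \<le> m * (real m - 1) * \<sigma>"
    using Suc E [of m] by (cases m) (simp_all add: \<sigma>_def)
  ultimately have "\<bar>E (Suc m) - Suc m * (\<Sum>v\<in>D. w v)\<bar> \<le> m * (real m - 1) * \<sigma> + 2 * m * \<sigma>"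
    by (simp add: algebra_simps)
  also have "\<dots> = Suc m * m * \<sigma>" by (simp add: algebra_simps)
  finally show ?case
    using E [OF Suc.prems] by (simp add: \<sigma>_def algebra_simps del: select.simps)
qed simp

end

text \<open>One functional covers the total in-degree, the sum of squares and the number of nodes of
  a given in-degree, so the effect of a growth step is computed only once.\<close>

definition degree_sum :: "(nat \<Rightarrow> real) \<Rightarrow> network \<Rightarrow> real" where
  "degree_sum F H = (\<Sum>v\<in>pverts H. F (in_degree H v))"

context growth_step
begin

text \<open>The quadratic bound serves for small \<open>m\<close>. The trivial bound
  \<open>m\<close> serves for the tail of \<open>A\<close>, where only a first moment is
  available.\<close>

lemma expectation_select_card_bounds:
  assumes D: "D \<subseteq> V" and m: "m \<le> nodes"
  shows "\<bar>measure_pmf.expectation (select p G m) (\<lambda>S. real (card (S \<inter> D))) - m * (\<Sum>v\<in>D. w v)\<bar>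
    \<le> min (real m) ((real m)\<^sup>2 * (\<Sum>v\<in>V. (w v)\<^sup>2))"
proof -
  define E where "E = measure_pmf.expectation (select p G m) (\<lambda>S. real (card (S \<inter> D)))"
  define \<sigma> where "\<sigma> = (\<Sum>v\<in>V. (w v)\<^sup>2)"
  have "card (S \<inter> D) \<le> m" if "S \<in> set_pmf (select p G m)" for S
    using set_select [OF m that] card_mono [of S "S \<inter> D"] finite_subset [of S V] by auto
  then have "E \<le> measure_pmf.expectation (select p G m) (\<lambda>S. real m)"
    unfolding E_def by (intro expectation_mono_pmf_finite finite_set_select m) auto
  then have "E \<le> m" by simp
  moreover have "0 \<le> E" by (simp add: E_def integral_nonneg)
  moreover have "(\<Sum>v\<in>D. w v) \<le> 1"
    using D sum_w sum_mono2 [of V D "\<lambda>v. w v"] by simp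
  then have "m * (\<Sum>v\<in>D. w v) \<le> m" by (simp add: mult_left_le)
  moreover have "0 \<le> m * (\<Sum>v\<in>D. w v)" by (simp add: sum_nonneg)
  moreover have "0 \<le> \<sigma>" by (simp add: \<sigma>_def sum_nonneg)
  then have "real m * (real m - 1) * \<sigma> \<le> (real m)\<^sup>2 * \<sigma>"
    by (intro mult_right_mono) (auto simp: power2_eq_square algebra_simps)
  ultimately show ?thesis
    using expectation_select_card [OF D m] unfolding E_def [symmetric] \<sigma>_def [symmetric] by linarith
qed

lemma sum_w_squared_le: "(\<Sum>v\<in>V. (w v)\<^sup>2) \<le> 1"
proof -
  have "(\<Sum>v\<in>V. (w v)\<^sup>2) \<le> (\<Sum>v\<in>V. w v)"
    by (intro sum_mono) (auto simp: power2_eq_square pmf_le_1 mult_left_le)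
  then show ?thesis by (simp add: sum_w)
qed

text \<open>Arcs are pairs, so an arc into \<open>v\<close> is determined by its tail. Loops are
  possible, so \<open>v\<close> itself counts among the tails.\<close>

lemma in_degree_le_nodes: "in_degree G v \<le> nodes"
proof -
  have "in_arcs G v \<subseteq> (\<lambda>u. (u, v)) ` V"
    using pair_fin_digraph.axioms(1) [OF digraph]
    by (force simp: in_arcs_def pair_wf_digraph_def)
  then have "card (in_arcs G v) \<le> card ((\<lambda>u. (u, v)) ` V)"
    by (intro card_mono) auto
  also have "\<dots> \<le> nodes" by (intro card_image_le) simp
  finally show ?thesis by (simp add: in_degree_def)
qed

section \<open>The network after one growth step\<close>

abbreviation "new_node \<equiv> Suc (Max V)"

lemma new_node_notin: "new_node \<notin> V"
  using Max_ge [OF finite_V, of new_node] by (metis Suc_n_not_le_n)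

lemma pverts_grow: "pverts (grow G S R) = insert new_node V"
  by (simp add: grow_def Let_def)

lemma card_pverts_grow: "card (pverts (grow G S R)) = Suc nodes"
  using new_node_notin by (simp add: pverts_grow)

lemma parcs_V: "(u, v) \<in> parcs G \<Longrightarrow> u \<in> V \<and> v \<in> V"
  using digraph pair_wf_digraph.wellformed' [of G u v] by (auto simp: pair_fin_digraph_def)

lemma growth_step_grow:
  assumes S: "S \<subseteq> V" "R \<subseteq> S"
  shows "growth_step p q (grow G S R)"
proof -
  have fin: "finite S" "finite R" using S finite_V finite_subset by metis+
  have "finite (parcs G)" using digraph by (simp add: pair_fin_digraph_def pair_fin_digraph_axioms_def)
  then have "pair_fin_digraph (grow G S R)"
    using S fin parcs_V
    by unfold_locales (auto simp: grow_def Let_def)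
  then show ?thesis using p q by (simp add: growth_step_def pverts_grow)
qed

lemma in_degree_grow:
  assumes S: "S \<subseteq> V" "R \<subseteq> S" and v: "v \<in> V"
  shows "in_degree (grow G S R) v = in_degree G v + (if v \<in> S then 1 else 0)"
proof -
  have "in_arcs (grow G S R) v = in_arcs G v \<union> (if v \<in> S then {(new_node, v)} else {})"
    using v new_node_notin by (auto simp: in_arcs_def grow_def Let_def)
  moreover have "finite (in_arcs G v)"
    using digraph by (auto simp: in_arcs_def pair_fin_digraph_def pair_fin_digraph_axioms_def)
  moreover have "(new_node, v) \<notin> in_arcs G v"
    using new_node_notin parcs_V by (auto simp: in_arcs_def)
  ultimately show ?thesis by (auto simp: in_degree_def)
qed

lemma in_degree_grow_new_node:
  assumes S: "S \<subseteq> V" "R \<subseteq> S"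
  shows "in_degree (grow G S R) new_node = card R"
proof -
  have "in_arcs (grow G S R) new_node = (\<lambda>u. (u, new_node)) ` R"
    using new_node_notin S parcs_V by (auto simp: in_arcs_def grow_def Let_def)
  then show ?thesis by (simp add: in_degree_def card_image inj_on_def)
qed

lemma sum_in_degree_grow:
  fixes F :: "nat \<Rightarrow> real"
  assumes S: "S \<subseteq> V" "R \<subseteq> S"
  shows "degree_sum F (grow G S R) = degree_sum F G + (\<Sum>v\<in>S. F (Suc (in_degree G v)) - F (in_degree G v)) + F (card R)"
proof -
  have "degree_sum F (grow G S R)
    = F (card R) + (\<Sum>v\<in>V. F (in_degree (grow G S R) v))"
    using new_node_notin by (simp add: degree_sum_def pverts_grow in_degree_grow_new_node [OF S])
  also have "(\<Sum>v\<in>V. F (in_degree (grow G S R) v))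
    = (\<Sum>v\<in>V. F (in_degree G v) + (if v \<in> S then F (Suc (in_degree G v)) - F (in_degree G v) else 0))"
    by (intro sum.cong refl) (simp add: in_degree_grow [OF S])
  also have "\<dots> = (\<Sum>v\<in>V. F (in_degree G v)) + (\<Sum>v\<in>V \<inter> S. F (Suc (in_degree G v)) - F (in_degree G v))"
    by (simp add: sum.distrib sum.inter_restrict)
  also have "V \<inter> S = S" using S by auto
  finally show ?thesis by (simp add: degree_sum_def)
qed

lemma total_in_degree_grow:
  assumes S: "S \<subseteq> V" "R \<subseteq> S"
  shows "total_in_degree (grow G S R) = total_in_degree G + card S + card R"
proof -
  have "real (total_in_degree (grow G S R)) = real (total_in_degree G + card S + card R)"
    using sum_in_degree_grow [OF S, of real] by (simp add: degree_sum_def total_in_degree_def)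
  then show ?thesis by (simp only: of_nat_eq_iff)
qed

lemma reciprocate_props:
  assumes "finite S"
  shows "set_pmf (reciprocate q S) \<subseteq> Pow S"
    and "map_pmf card (reciprocate q S) = binomial_pmf (card S) q"
proof -
  show "set_pmf (reciprocate q S) \<subseteq> Pow S" by (auto simp: reciprocate_def)
  have "map_pmf card (reciprocate q S)
      = map_pmf (\<lambda>b. card {v \<in> S. b v}) (Pi_pmf S False (\<lambda>_. bernoulli_pmf q))"
    by (simp add: reciprocate_def map_pmf_comp o_def)
  also have "\<dots> = binomial_pmf (card S) q"
    using assms q by (intro binomial_pmf_altdef' [symmetric]) auto
  finally show "map_pmf card (reciprocate q S) = binomial_pmf (card S) q" .
qed

lemma set_evolve:
  assumes "H \<in> set_pmf (evolve p q a G)"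
  shows "\<exists>S R. S \<subseteq> V \<and> R \<subseteq> S \<and> H = grow G S R"
proof -
  obtain S R where SR: "S \<in> set_pmf (select p G (min a nodes))" "R \<in> set_pmf (reciprocate q S)"
      "H = grow G S R"
    using assms by (auto simp: evolve_def)
  have "S \<subseteq> V" using set_select [OF min.cobounded2 SR(1)] by blast
  moreover have "R \<subseteq> S"
    using SR(2) reciprocate_props(1) [OF finite_subset [OF \<open>S \<subseteq> V\<close> finite_V]] by blast
  ultimately show ?thesis using SR(3) by blast
qed

text \<open>The outcome is determined by two subsets of \<open>V\<close>, whatever the value of
  \<open>a\<close>. The union over all \<open>a\<close> therefore stays finite even if
  \<open>A\<close> has infinite support.\<close>

lemma finite_set_evolve: "finite (\<Union>a. set_pmf (evolve p q a G))"
proof (rule finite_subset)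
  show "(\<Union>a. set_pmf (evolve p q a G)) \<subseteq> (\<lambda>(S, R). grow G S R) ` (Pow V \<times> Pow V)"
    using set_evolve by fast
qed simp

lemma finite_set_evolve': "finite (set_pmf (evolve p q a G))"
  using finite_set_evolve by (rule finite_subset [rotated]) blast

text \<open>An observable that sees \<open>R\<close> only through \<open>card R\<close> decouples
  from the choice of \<open>S\<close>: the size of \<open>S\<close> is fixed, so the number of
  reciprocated edges has the same binomial law for every \<open>S\<close>.\<close>

lemma expectation_evolve:
  fixes h :: "network \<Rightarrow> real" and g :: "nat set \<Rightarrow> nat \<Rightarrow> real"
  assumes h: "\<And>S R. S \<subseteq> V \<Longrightarrow> R \<subseteq> S \<Longrightarrow> h (grow G S R) = g S (card R)"
  shows "measure_pmf.expectation (evolve p q a G) h =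
    measure_pmf.expectation (select p G (min a nodes))
      (\<lambda>S. measure_pmf.expectation (binomial_pmf (min a nodes) q) (g S))"
proof -
  have "measure_pmf.expectation (evolve p q a G) h =
    measure_pmf.expectation (select p G (min a nodes))
      (\<lambda>S. measure_pmf.expectation (reciprocate q S) (\<lambda>R. h (grow G S R)))"
    using finite_set_evolve' [of a] unfolding evolve_def
    by (subst expectation_bind_pmf_finite) auto
  also have "\<dots> = measure_pmf.expectation (select p G (min a nodes))
      (\<lambda>S. measure_pmf.expectation (binomial_pmf (min a nodes) q) (g S))"
  proof (rule expectation_cong_pmf)
    fix S assume "S \<in> set_pmf (select p G (min a nodes))"
    then have S: "S \<subseteq> V" "card S = min a nodes" using set_select [OF min.cobounded2] by blast+
    then have fin: "finite S" using finite_subset finite_V by blast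
    have "measure_pmf.expectation (reciprocate q S) (\<lambda>R. h (grow G S R))
      = measure_pmf.expectation (reciprocate q S) (\<lambda>R. g S (card R))"
      using h [OF S(1)] reciprocate_props(1) [OF fin] by (intro expectation_cong_pmf) auto
    also have "\<dots> = measure_pmf.expectation (map_pmf card (reciprocate q S)) (g S)"
      by simp
    finally show "measure_pmf.expectation (reciprocate q S) (\<lambda>R. h (grow G S R))
      = measure_pmf.expectation (binomial_pmf (min a nodes) q) (g S)"
      using reciprocate_props(2) [OF fin] S(2) by simp
  qed
  finally show ?thesis .
qed

lemma finite_set_binomial [simp]: "finite (set_pmf (binomial_pmf m q))"
  using q by (intro finite_subset [OF _ finite_atMost [of m]]) (auto simp: set_pmf_binomial_eq split: if_splits)

lemma set_binomial_le: "r \<in> set_pmf (binomial_pmf m q) \<Longrightarrow> r \<le> m"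
  using q by (auto simp: set_pmf_binomial_eq split: if_splits)

lemma expectation_binomial: "measure_pmf.expectation (binomial_pmf m q) real = m * q"
  using q sum_k_Bernstein [of m q]
  by (simp add: expectation_binomial_pmf' Bernstein_def mult_ac)

lemma expectation_evolve_sum_in_degree:
  fixes F :: "nat \<Rightarrow> real"
  shows "measure_pmf.expectation (evolve p q a G) (degree_sum F) =
    degree_sum F G
    + measure_pmf.expectation (select p G (min a nodes))
        (\<lambda>S. \<Sum>v\<in>S. F (Suc (in_degree G v)) - F (in_degree G v))
    + measure_pmf.expectation (binomial_pmf (min a nodes) q) F"
  by (subst expectation_evolve [where g = "\<lambda>S r. degree_sum F G
        + (\<Sum>v\<in>S. F (Suc (in_degree G v)) - F (in_degree G v)) + F r"])
     (simp_all add: sum_in_degree_grow integrable_measure_pmf_finite finite_set_select)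

text \<open>The total in-degree grows by \<open>card S + card R\<close>, and \<open>card S\<close>
  is deterministic, so only the binomial randomness remains.\<close>

lemma expectation_evolve_edges:
  fixes F :: "real \<Rightarrow> real" and c :: real
  shows "measure_pmf.expectation (evolve p q a G) (\<lambda>H. F (real (total_in_degree H) - c * card (pverts H)))
    = measure_pmf.expectation (binomial_pmf (min a nodes) q)
        (\<lambda>r. F (edges - c * nodes + min a nodes + r - c))"
proof -
  have "measure_pmf.expectation (evolve p q a G) (\<lambda>H. F (real (total_in_degree H) - c * card (pverts H)))
    = measure_pmf.expectation (select p G (min a nodes)) (\<lambda>S.
        measure_pmf.expectation (binomial_pmf (min a nodes) q) (\<lambda>r. F (edges + card S + r - c * Suc nodes)))"
    by (rule expectation_evolve [where g = "\<lambda>S r. F (edges + card S + r - c * Suc nodes)"])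
       (simp add: total_in_degree_grow card_pverts_grow)
  also have "\<dots> = measure_pmf.expectation (select p G (min a nodes)) (\<lambda>S.
        measure_pmf.expectation (binomial_pmf (min a nodes) q)
          (\<lambda>r. F (edges - c * nodes + min a nodes + r - c)))"
  proof (rule expectation_cong_pmf)
    fix S assume "S \<in> set_pmf (select p G (min a nodes))"
    then have S: "card S = min a nodes" using set_select [OF min.cobounded2] by blast
    have "edges + card S + r - c * Suc nodes = edges - c * nodes + min a nodes + r - c" for r :: real
      unfolding S by (simp only: of_nat_Suc) (simp add: algebra_simps)
    then show "measure_pmf.expectation (binomial_pmf (min a nodes) q) (\<lambda>r. F (edges + card S + r - c * Suc nodes))
      = measure_pmf.expectation (binomial_pmf (min a nodes) q)
          (\<lambda>r. F (edges - c * nodes + min a nodes + r - c))"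
      by (simp only:)
  qed
  finally show ?thesis by simp
qed

text \<open>Here \<open>g\<close> is the current deviation of the edge count. The term linear in
  \<open>g\<close> is kept exact through the binomial mean, because \<open>g\<close> may be large;
  the squared increment is bounded crudely by \<open>r \<le> m\<close>.\<close>

lemma expectation_binomial_edges_le:
  fixes g c :: real
  shows "measure_pmf.expectation (binomial_pmf m q) (\<lambda>r. (g + m + r - c)\<^sup>2)
    \<le> g\<^sup>2 + 2 * g * ((1 + q) * m - c) + (8 * (real m)\<^sup>2 + 2 * c\<^sup>2)"
proof -
  have "measure_pmf.expectation (binomial_pmf m q) (\<lambda>r. (g + m + r - c)\<^sup>2)
    \<le> measure_pmf.expectation (binomial_pmf m q)
        (\<lambda>r. g\<^sup>2 + 2 * g * (m - c) + 2 * g * r + (8 * (real m)\<^sup>2 + 2 * c\<^sup>2))"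
  proof (rule expectation_mono_pmf_finite)
    fix r assume "r \<in> set_pmf (binomial_pmf m q)"
    then have r: "r \<le> m" by (rule set_binomial_le)
    have "(real m + real r - c)\<^sup>2 \<le> 2 * (real m + real r)\<^sup>2 + 2 * c\<^sup>2"
      using zero_le_power2 [of "real m + real r + c"] by (simp add: power2_eq_square algebra_simps)
    also have "(real m + real r)\<^sup>2 \<le> (2 * real m)\<^sup>2"
      using r by (intro power_mono) auto
    finally have "(real m + real r - c)\<^sup>2 \<le> 8 * (real m)\<^sup>2 + 2 * c\<^sup>2"
      by (simp add: power_mult_distrib)
    moreover have "(g + m + r - c)\<^sup>2 = g\<^sup>2 + 2 * g * (m - c) + 2 * g * r + (real m + real r - c)\<^sup>2"
      by (simp add: power2_eq_square algebra_simps)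
    ultimately show "(g + m + r - c)\<^sup>2 \<le> g\<^sup>2 + 2 * g * (m - c) + 2 * g * r + (8 * (real m)\<^sup>2 + 2 * c\<^sup>2)"
      by simp
  qed simp
  also have "\<dots> = g\<^sup>2 + 2 * g * (m - c) + 2 * g * (m * q) + (8 * (real m)\<^sup>2 + 2 * c\<^sup>2)"
    using q by (simp add: integrable_measure_pmf_finite expectation_binomial)
  finally show ?thesis by (simp add: algebra_simps)
qed

text \<open>A selected node of in-degree \<open>d\<close> adds \<open>2 * d + 1\<close>, and the
  in-degree is aligned, so \<open>m\<close> draws without replacement add no more than
  \<open>m\<close> independent ones. The new node adds at most \<open>m\<close> squared.\<close>

lemma expectation_evolve_squares_le:
  "measure_pmf.expectation (evolve p q a G) (degree_sum (\<lambda>d. (real d)\<^sup>2))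
    \<le> degree_sum (\<lambda>d. (real d)\<^sup>2) G + real (min a nodes) * (2 * (\<Sum>v\<in>V. w v * deg v) + 1) + (real (min a nodes))\<^sup>2"
proof -
  define m where "m = min a nodes"
  have m: "m \<le> nodes" by (simp add: m_def)
  have "measure_pmf.expectation (select p G m) (\<lambda>S. \<Sum>v\<in>S. (real (Suc (in_degree G v)))\<^sup>2 - (deg v)\<^sup>2)
    = measure_pmf.expectation (select p G m) (\<lambda>S. 2 * (\<Sum>v\<in>S. deg v) + real m)"
  proof (rule expectation_cong_pmf)
    fix S assume "S \<in> set_pmf (select p G m)"
    then have "card S = m" using set_select m by blast
    moreover have "(\<Sum>v\<in>S. (real (Suc (in_degree G v)))\<^sup>2 - (deg v)\<^sup>2) = (\<Sum>v\<in>S. 2 * deg v + 1)"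
      by (intro sum.cong refl) (simp add: power2_eq_square algebra_simps)
    ultimately show "(\<Sum>v\<in>S. (real (Suc (in_degree G v)))\<^sup>2 - (deg v)\<^sup>2) = 2 * (\<Sum>v\<in>S. deg v) + m"
      by (simp add: sum.distrib sum_distrib_left)
  qed
  also have "\<dots> = 2 * measure_pmf.expectation (select p G m) (\<lambda>S. \<Sum>v\<in>S. deg v) + m"
    using m by (simp add: integrable_measure_pmf_finite finite_set_select)
  also have "\<dots> \<le> 2 * (m * (\<Sum>v\<in>V. w v * deg v)) + m"
    using expectation_select_sum_le [OF aligned_deg m] by simp
  finally have "measure_pmf.expectation (select p G m) (\<lambda>S. \<Sum>v\<in>S. (real (Suc (in_degree G v)))\<^sup>2 - (deg v)\<^sup>2)
    \<le> real m * (2 * (\<Sum>v\<in>V. w v * deg v) + 1)" by (simp add: algebra_simps)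
  moreover have "measure_pmf.expectation (binomial_pmf m q) (\<lambda>r. (real r)\<^sup>2)
    \<le> measure_pmf.expectation (binomial_pmf m q) (\<lambda>r. (real m)\<^sup>2)"
    by (intro expectation_mono_pmf_finite) (auto dest: set_binomial_le)
  ultimately show ?thesis
    unfolding expectation_evolve_sum_in_degree m_def [symmetric] by simp
qed

end

section \<open>One step with a random number of edges\<close>

lemma expectation_tendsto_dominated:
  fixes s :: "nat \<Rightarrow> 'a \<Rightarrow> real"
  assumes "integrable (measure_pmf M) g" "\<And>x. x \<in> set_pmf M \<Longrightarrow> (\<lambda>i. s i x) \<longlonglongrightarrow> f x"
    and "\<And>i x. x \<in> set_pmf M \<Longrightarrow> \<bar>s i x\<bar> \<le> g x"
  shows "(\<lambda>i. measure_pmf.expectation M (s i)) \<longlonglongrightarrow> measure_pmf.expectation M f"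
  by (rule integral_dominated_convergence [where w = g])
     (use assms in \<open>auto simp: AE_measure_pmf_iff\<close>)

lemma expectation_mono_pmf:
  fixes f g :: "'a \<Rightarrow> real"
  assumes "integrable (measure_pmf M) f" "integrable (measure_pmf M) g"
    and "\<And>x. x \<in> set_pmf M \<Longrightarrow> f x \<le> g x"
  shows "measure_pmf.expectation M f \<le> measure_pmf.expectation M g"
  using assms by (intro integral_mono_AE AE_pmfI) auto

locale growth_process =
  fixes p q :: real and A :: "nat pmf"
  assumes p: "0 \<le> p" "p \<le> 1" and q: "0 < q" "q \<le> 1"
    and integrable_A: "integrable (measure_pmf A) real"
    and mean_pos: "0 < measure_pmf.expectation A real"
begin

definition "\<mu> = measure_pmf.expectation A real"
definition "\<Lambda> = (1 + q) * \<mu>"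

text \<open>Average over the number of nodes actually selected in a network of \<open>n\<close>
  nodes. The truncation leaves only finitely many values, so every \<open>F\<close> is
  integrable.\<close>

abbreviation avg :: "nat \<Rightarrow> (nat \<Rightarrow> real) \<Rightarrow> real" where
  "avg n F \<equiv> measure_pmf.expectation A (\<lambda>a. F (min a n))"

definition "tail_mean L = measure_pmf.expectation A (\<lambda>a. if a > L then real a else 0)" for L :: nat
text \<open>The probability that a node joining a network of \<open>n\<close> nodes starts with
  in-degree \<open>k\<close>.\<close>

definition "born n k = avg n (\<lambda>m. pmf (binomial_pmf m q) k)"

lemma \<mu>_pos: "\<mu> > 0" using mean_pos by (simp add: \<mu>_def)

lemma \<Lambda>_pos: "\<Lambda> > 0" using \<mu>_pos q by (simp add: \<Lambda>_def)

lemma integrable_avg [simp]: "integrable (measure_pmf A) (\<lambda>a. F (min a n) :: real)"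
  by (rule measure_pmf.integrable_const_bound [where B = "Max ((\<lambda>m. \<bar>F m\<bar>) ` {..n})"])
     (auto intro!: Max_ge)

lemma avg_le_\<mu>: "avg n real \<le> \<mu>"
  unfolding \<mu>_def by (rule expectation_mono_pmf) (auto simp: integrable_A)

lemma avg_nonneg: "0 \<le> avg n real"
  by (simp add: integral_nonneg)

lemma min_tendsto: "(\<lambda>n. F (min a n)) \<longlonglongrightarrow> F a" for F :: "nat \<Rightarrow> real"
proof (rule tendsto_eventually)
  show "\<forall>\<^sub>F n in sequentially. F (min a n) = F a"
    using eventually_ge_at_top [of a] by eventually_elim simp
qed

lemma avg_tendsto: "(\<lambda>n. avg n real) \<longlonglongrightarrow> \<mu>"
  unfolding \<mu>_def by (rule expectation_tendsto_dominated [OF integrable_A min_tendsto]) simp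

lemma born_tendsto: "(\<lambda>n. born n k) \<longlonglongrightarrow> measure_pmf.expectation A (\<lambda>a. pmf (binomial_pmf a q) k)"
  unfolding born_def
  by (rule expectation_tendsto_dominated [where g = "\<lambda>_. 1", OF _ min_tendsto])
     (auto simp: pmf_le_1 simp del: pmf_binomial)

text \<open>The quotient of the squared \<open>min a n\<close> by \<open>n\<close> is at most
  \<open>a\<close> and tends to 0 for fixed \<open>a\<close>, so a first moment of \<open>A\<close>
  suffices for dominated convergence.\<close>

lemma second_moment_tendsto: "(\<lambda>n. avg n (\<lambda>m. (real m)\<^sup>2) / real n) \<longlonglongrightarrow> 0"
proof -
  have "(\<lambda>n. measure_pmf.expectation A (\<lambda>a. (real (min a n))\<^sup>2 / real n)) \<longlonglongrightarrow>
      measure_pmf.expectation A (\<lambda>a. 0)"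
  proof (rule expectation_tendsto_dominated [OF integrable_A])
    fix a
    have "(\<lambda>n. (real a)\<^sup>2 / real n) \<longlonglongrightarrow> 0"
      by (rule lim_const_over_n)
    moreover have "\<forall>\<^sub>F n in sequentially. (real a)\<^sup>2 / real n = (real (min a n))\<^sup>2 / real n"
      using eventually_ge_at_top [of a] by eventually_elim simp
    ultimately show "(\<lambda>n. (real (min a n))\<^sup>2 / real n) \<longlonglongrightarrow> 0"
      by (rule Lim_transform_eventually)
  next
    fix n a :: nat
    have "(real (min a n))\<^sup>2 \<le> real a * real n"
      unfolding power2_eq_square by (intro mult_mono) auto
    then show "\<bar>(real (min a n))\<^sup>2 / real n\<bar> \<le> real a"
      by (cases "n = 0") (auto simp: field_simps)
  qed
  then show ?thesis by simp
qed

lemma tail_mean_tendsto: "tail_mean \<longlonglongrightarrow> 0"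
proof -
  have "(\<lambda>L. measure_pmf.expectation A (\<lambda>a. if a > L then real a else 0)) \<longlonglongrightarrow>
      measure_pmf.expectation A (\<lambda>a. 0)"
  proof (rule expectation_tendsto_dominated [OF integrable_A])
    fix a
    show "(\<lambda>L. if a > L then real a else 0) \<longlonglongrightarrow> 0"
      by (intro tendsto_eventually eventually_mono [OF eventually_ge_at_top [of a]]) auto
  qed simp
  then show ?thesis by (simp add: tail_mean_def [abs_def])
qed

text \<open>Splits \<open>A\<close> at the level \<open>L\<close>: larger values are charged
  linearly to the tail mean, smaller ones use the quadratic bound with
  \<open>m \<le> L\<close>.\<close>

lemma avg_min_le:
  assumes "0 \<le> \<sigma>"
  shows "avg n (\<lambda>m. min (real m) ((real m)\<^sup>2 * \<sigma>)) \<le> tail_mean L + (real L)\<^sup>2 * \<sigma>"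
proof -
  have int: "integrable (measure_pmf A) (\<lambda>a. if a > L then real a else 0)"
    by (rule Bochner_Integration.integrable_bound [OF integrable_A]) auto
  have "avg n (\<lambda>m. min (real m) ((real m)\<^sup>2 * \<sigma>))
    \<le> measure_pmf.expectation A (\<lambda>a. (if a > L then real a else 0) + (real L)\<^sup>2 * \<sigma>)"
  proof (rule expectation_mono_pmf)
    fix a
    define m where "m = min a n"
    have m: "real m \<le> real a" by (simp add: m_def)
    show "min (real (min a n)) ((real (min a n))\<^sup>2 * \<sigma>) \<le> (if a > L then real a else 0) + (real L)\<^sup>2 * \<sigma>"
    proof (cases "a > L")
      case True
      have "0 \<le> (real L)\<^sup>2 * \<sigma>" using assms by simp
      then show ?thesis using True m unfolding m_def [symmetric] by simp
    next
      case False
      have "(real m)\<^sup>2 * \<sigma> \<le> (real L)\<^sup>2 * \<sigma>"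
        using False m assms by (intro mult_right_mono power_mono) auto
      then show ?thesis using False unfolding m_def [symmetric] by simp
    qed
  qed (use int integrable_avg [of "\<lambda>m. min (real m) ((real m)\<^sup>2 * \<sigma>)"] in auto)
  also have "\<dots> = tail_mean L + (real L)\<^sup>2 * \<sigma>"
    using int by (simp add: tail_mean_def)
  finally show ?thesis .
qed

definition step :: "network \<Rightarrow> network pmf" where
  "step G = bind_pmf A (\<lambda>a. evolve p q a G)"

abbreviation good :: "network \<Rightarrow> bool" where "good \<equiv> growth_step p q"

lemma good_step:
  assumes "good G" "H \<in> set_pmf (step G)"
  shows "good H" "card (pverts H) = Suc (card (pverts G))"
proof -
  interpret growth_step p q G by fact
  obtain a where "H \<in> set_pmf (evolve p q a G)"
    using assms(2) by (auto simp: step_def)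
  then obtain S R where SR: "S \<subseteq> V" "R \<subseteq> S" "H = grow G S R"
    using set_evolve by blast
  then show "good H" "card (pverts H) = Suc (card (pverts G))"
    using growth_step_grow card_pverts_grow by auto
qed

lemma finite_set_step: "good G \<Longrightarrow> finite (set_pmf (step G))"
  unfolding step_def set_bind_pmf
  by (rule finite_subset [OF _ growth_step.finite_set_evolve [of p q G]]) auto

lemma expectation_step:
  fixes h :: "network \<Rightarrow> real"
  assumes "good G"
  shows "measure_pmf.expectation (step G) h
    = avg (card (pverts G)) (\<lambda>m. measure_pmf.expectation (evolve p q m G) h)"
proof -
  \<comment> \<open>\<open>evolve\<close> truncates \<open>a\<close> itself, so truncating
    beforehand changes nothing and the average over \<open>A\<close> takes the form
    \<open>avg\<close>.\<close>
  have "evolve p q (min a (card (pverts G))) G = evolve p q a G" for a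
    by (simp add: evolve_def min.assoc)
  then show ?thesis
    using finite_set_step [OF assms] by (simp add: step_def expectation_bind_pmf_finite)
qed

lemma avg_mono: "(\<And>m. m \<le> n \<Longrightarrow> F m \<le> F' m) \<Longrightarrow> avg n F \<le> avg n F'"
  by (rule expectation_mono_pmf) (auto intro: integrable_avg)

section \<open>Drift of the edge count, the sum of squares and the degree counts\<close>

definition gap :: "network \<Rightarrow> real" where
  "gap G = real (total_in_degree G) - \<Lambda> * card (pverts G)"

definition squares :: "network \<Rightarrow> real" where
  "squares = degree_sum (\<lambda>d. (real d)\<^sup>2)"

definition deg_count :: "nat \<Rightarrow> network \<Rightarrow> real" where
  "deg_count k = degree_sum (\<lambda>d. if d = k then 1 else 0)"

text \<open>The probability that two independent draws coincide; it measures how far selection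
  without replacement is from independent draws.\<close>

definition concentration :: "network \<Rightarrow> real" where
  "concentration G = (\<Sum>v\<in>pverts G. (pmf (attach_pmf p G) v)\<^sup>2)"

text \<open>The mean increment of \<open>gap\<close> is
  \<open>- (\<mu> - avg n real) * (1 + q)\<close>, caused only by truncating \<open>A\<close> at
  \<open>n\<close>, and this tends to 0 as \<open>n\<close> grows. The remaining terms are the
  squared increment.\<close>

lemma expectation_step_gap_le:
  assumes "good G"
  defines "n \<equiv> card (pverts G)"
  shows "measure_pmf.expectation (step G) (\<lambda>H. (gap H)\<^sup>2)
    \<le> (1 + (\<mu> - avg n real) * (1 + q) / n) * (gap G)\<^sup>2
      + ((\<mu> - avg n real) * (1 + q) * n + 8 * avg n (\<lambda>m. (real m)\<^sup>2) + 2 * \<Lambda>\<^sup>2)"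
proof -
  interpret growth_step p q G by fact
  have n: "n > 0" using nodes_pos by (simp add: n_def)
  define \<delta> where "\<delta> = (\<mu> - avg n real) * (1 + q)"
  have \<delta>: "\<delta> \<ge> 0" using avg_le_\<mu> q by (simp add: \<delta>_def)
  define g where "g = gap G"
  have "measure_pmf.expectation (step G) (\<lambda>H. (gap H)\<^sup>2)
    \<le> avg n (\<lambda>m. g\<^sup>2 + 2 * g * ((1 + q) * m - \<Lambda>) + (8 * (real m)\<^sup>2 + 2 * \<Lambda>\<^sup>2))"
    unfolding expectation_step [OF assms(1)] n_def [symmetric]
  proof (rule avg_mono)
    fix m assume "m \<le> n"
    then have m: "min m nodes = m" by (simp add: n_def)
    show "measure_pmf.expectation (evolve p q m G) (\<lambda>H. (gap H)\<^sup>2)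
      \<le> g\<^sup>2 + 2 * g * ((1 + q) * m - \<Lambda>) + (8 * (real m)\<^sup>2 + 2 * \<Lambda>\<^sup>2)"
      using expectation_evolve_edges [of m "\<lambda>x. x\<^sup>2" \<Lambda>] expectation_binomial_edges_le [of m g \<Lambda>]
      unfolding m gap_def g_def by simp
  qed
  also have "\<dots> = g\<^sup>2 + 2 * g * ((1 + q) * avg n real - \<Lambda>) + (8 * avg n (\<lambda>m. (real m)\<^sup>2) + 2 * \<Lambda>\<^sup>2)"
    using integrable_avg [of real n] integrable_avg [of "\<lambda>m. (real m)\<^sup>2" n]
    by (simp add: right_diff_distrib mult.assoc)
  also have "(1 + q) * avg n real - \<Lambda> = - \<delta>" by (simp add: \<delta>_def \<Lambda>_def algebra_simps)
  \<comment> \<open>The arithmetic-geometric mean inequality, weighted by \<open>n\<close> so that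
    the coefficient of \<open>g\<^sup>2\<close> is of order \<open>\<delta> / n\<close>, as the
    quadratic recursion demands.\<close>
  also have "2 * g * (- \<delta>) \<le> \<delta> * (g\<^sup>2 / n + n)"
  proof -
    have "0 \<le> (g + n)\<^sup>2 / n" by simp
    then have "- (2 * g) \<le> g\<^sup>2 / n + n"
      using n by (simp add: power2_eq_square field_simps)
    then have "\<delta> * (- (2 * g)) \<le> \<delta> * (g\<^sup>2 / n + n)" using \<delta> by (rule mult_left_mono)
    then show ?thesis by (simp add: mult_ac)
  qed
  finally show ?thesis
    unfolding g_def [symmetric] \<delta>_def [symmetric] by (simp add: algebra_simps)
qed

text \<open>As in Chebyshev's inequality, the indicator of too few edges is dominated by a multiple
  of the squared relative gap, whose mean will tend to 0.\<close>

lemma gap_large_if_edges_small: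
  assumes "good G" "1 < \<theta>" and e: "real (total_in_degree G) < \<Lambda> * card (pverts G) / \<theta>"
  shows "1 \<le> (gap G)\<^sup>2 / (card (pverts G))\<^sup>2 / (\<Lambda> * (1 - 1 / \<theta>))\<^sup>2"
proof -
  interpret growth_step p q G by fact
  define c where "c = \<Lambda> * (1 - 1 / \<theta>)"
  have c: "c > 0" using \<Lambda>_pos \<open>1 < \<theta>\<close> by (simp add: c_def)
  have "c * nodes \<le> - gap G" using e by (simp add: c_def gap_def algebra_simps)
  then have "(c * nodes)\<^sup>2 \<le> (- gap G)\<^sup>2"
    using c by (intro power_mono) auto
  moreover have "0 < (c * nodes)\<^sup>2" using c nodes_pos nonempty by simp
  ultimately have "1 \<le> (gap G)\<^sup>2 / (c * nodes)\<^sup>2" by (simp only: pos_le_divide_eq) simp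
  then show ?thesis
    unfolding c_def [symmetric] by (simp add: power_mult_distrib mult.commute)
qed

lemma squares_le: "good G \<Longrightarrow> squares G \<le> card (pverts G) * real (total_in_degree G)"
proof -
  assume "good G"
  then interpret growth_step p q G .
  have "(\<Sum>v\<in>V. (deg v)\<^sup>2) \<le> (\<Sum>v\<in>V. nodes * deg v)"
    using in_degree_le_nodes by (intro sum_mono) (simp add: power2_eq_square mult_right_mono)
  then show ?thesis by (simp add: squares_def degree_sum_def edges_eq sum_distrib_left)
qed

lemma squares_nonneg: "0 \<le> squares G"
  by (simp add: squares_def degree_sum_def sum_nonneg)

lemma concentration_nonneg: "0 \<le> concentration G"
  by (simp add: concentration_def sum_nonneg)

text \<open>With at least \<open>\<Lambda> * n / 2\<close> edges, the weights are bounded by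
  in-degrees over \<open>\<Lambda> * n / 2\<close> and by \<open>1 / n\<close>. With fewer edges the
  trivial bound 1 is paid for by the gap.\<close>

lemma concentration_le:
  assumes "good G"
  defines "n \<equiv> card (pverts G)"
  shows "concentration G \<le> 1 / n + 4 / \<Lambda>\<^sup>2 * (squares G / n\<^sup>2 + (gap G)\<^sup>2 / n\<^sup>2)"
proof -
  interpret growth_step p q G by fact
  have n: "n > 0" using nodes_pos by (simp add: n_def)
  show ?thesis
  proof (cases "edges < \<Lambda> * n / 2")
    case True
    then have "1 \<le> (gap G)\<^sup>2 / n\<^sup>2 / (\<Lambda> * (1 - 1 / 2))\<^sup>2"
      using gap_large_if_edges_small [OF assms(1), of 2] by (simp add: n_def)
    also have "\<dots> = 4 / \<Lambda>\<^sup>2 * ((gap G)\<^sup>2 / n\<^sup>2)" by (simp add: power2_eq_square mult_ac)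
    finally have "1 \<le> 4 / \<Lambda>\<^sup>2 * ((gap G)\<^sup>2 / n\<^sup>2)" .
    moreover have "concentration G \<le> 1" using sum_w_squared_le by (simp add: concentration_def)
    moreover have "0 \<le> 1 / n + 4 / \<Lambda>\<^sup>2 * (squares G / n\<^sup>2)" using squares_nonneg by simp
    ultimately show ?thesis by (simp add: algebra_simps)
  next
    case False
    have L: "0 < \<Lambda> * n / 2" using \<Lambda>_pos n by simp
    then have e: "edges > 0" using False by linarith
    have "(w v)\<^sup>2 \<le> (deg v / edges)\<^sup>2 + (1 / n)\<^sup>2" if "v \<in> V" for v
    proof -
      define x y where "x = deg v / edges" and "y = 1 / real n"
      \<comment> \<open>Convexity of the square, with the defect written out.\<close>
      have "(p * x + (1 - p) * y)\<^sup>2 = p * x\<^sup>2 + (1 - p) * y\<^sup>2 - p * (1 - p) * (x - y)\<^sup>2"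
        by (simp add: power2_eq_square algebra_simps)
      also have "\<dots> \<le> p * x\<^sup>2 + (1 - p) * y\<^sup>2" using p by simp
      also have "\<dots> \<le> x\<^sup>2 + y\<^sup>2" using p by (intro add_mono mult_left_le_one_le) auto
      finally show ?thesis using w_mixed [OF _ that] e by (simp add: x_def y_def n_def)
    qed
    then have "concentration G \<le> (\<Sum>v\<in>V. (deg v / edges)\<^sup>2 + (1 / n)\<^sup>2)"
      unfolding concentration_def by (rule sum_mono)
    also have "\<dots> = squares G / edges\<^sup>2 + 1 / n"
      using n by (simp add: sum.distrib squares_def degree_sum_def power_divide sum_divide_distrib)
        (simp add: n_def power2_eq_square)
    also have "squares G / edges\<^sup>2 \<le> squares G / (\<Lambda> * n / 2)\<^sup>2"
      using False L by (intro divide_left_mono power_mono squares_nonneg mult_pos_pos zero_less_power)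
        (auto simp: e)
    also have "\<dots> = 4 / \<Lambda>\<^sup>2 * (squares G / n\<^sup>2)" by (simp add: power2_eq_square mult_ac)
    also have "\<dots> \<le> 4 / \<Lambda>\<^sup>2 * (squares G / n\<^sup>2 + (gap G)\<^sup>2 / n\<^sup>2)"
      by (intro mult_left_mono) auto
    finally show ?thesis by simp
  qed
qed

text \<open>In a network with edges, the mean in-degree of a drawn node is
  \<open>p * squares G / edges + (1 - p) * edges / n\<close>. If \<open>edges\<close> is at least
  \<open>\<Lambda> * n / \<theta>\<close>, the first quotient is at most
  \<open>\<theta> / \<Lambda> / n * squares G\<close>; otherwise it is at most \<open>n\<close>, and
  the gap pays for it.\<close>

lemma sum_w_deg_le:
  assumes "good G"
  defines "n \<equiv> card (pverts G)" and "\<theta> \<equiv> 1 + q / 2"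
  shows "(\<Sum>v\<in>pverts G. pmf (attach_pmf p G) v * real (in_degree G v))
    \<le> \<theta> / \<Lambda> / n * squares G + real n * ((gap G)\<^sup>2 / n\<^sup>2 / (\<Lambda> * (1 - 1 / \<theta>))\<^sup>2)
      + (\<Lambda> + 1 + (gap G)\<^sup>2 / n\<^sup>2)"
proof -
  interpret growth_step p q G by fact
  have n: "n > 0" using nodes_pos by (simp add: n_def)
  have \<theta>: "1 < \<theta>" using q by (simp add: \<theta>_def)
  have nonneg: "0 \<le> \<theta> / \<Lambda> / n * squares G" "0 \<le> real n * ((gap G)\<^sup>2 / n\<^sup>2 / (\<Lambda> * (1 - 1 / \<theta>))\<^sup>2)"
    "0 \<le> \<Lambda> + 1 + (gap G)\<^sup>2 / n\<^sup>2"
    using squares_nonneg \<theta> \<Lambda>_pos by auto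
  show ?thesis
  proof (cases "edges = 0")
    case True
    then have "(\<Sum>v\<in>V. w v * deg v) = 0" by (intro sum.neutral) (simp add: deg_0)
    then show ?thesis using nonneg by linarith
  next
    case False
    then have e: "edges > 0" by simp
    have "(\<Sum>v\<in>V. w v * deg v) = (\<Sum>v\<in>V. p * ((deg v)\<^sup>2 / edges) + (1 - p) * (deg v / n))"
      using False by (intro sum.cong refl) (simp add: w_mixed n_def power2_eq_square field_simps)
    also have "\<dots> = p * (squares G / edges) + (1 - p) * (edges / n)"
      by (simp add: sum.distrib sum_distrib_left [symmetric] sum_divide_distrib [symmetric]
          squares_def degree_sum_def edges_eq)
    also have "\<dots> \<le> squares G / edges + edges / n"
      using p squares_nonneg e by (intro add_mono mult_left_le_one_le) auto
    also have "squares G / edges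
        \<le> \<theta> / \<Lambda> / n * squares G + real n * ((gap G)\<^sup>2 / n\<^sup>2 / (\<Lambda> * (1 - 1 / \<theta>))\<^sup>2)"
    proof (cases "edges < \<Lambda> * n / \<theta>")
      case True
      then have "1 \<le> (gap G)\<^sup>2 / n\<^sup>2 / (\<Lambda> * (1 - 1 / \<theta>))\<^sup>2"
        using gap_large_if_edges_small [OF assms(1) \<theta>] by (simp add: n_def)
      then have "real n * 1 \<le> real n * ((gap G)\<^sup>2 / n\<^sup>2 / (\<Lambda> * (1 - 1 / \<theta>))\<^sup>2)"
        by (intro mult_left_mono) auto
      moreover have "squares G / edges \<le> n"
        using squares_le [OF assms(1)] e by (simp add: n_def pos_divide_le_eq)
      ultimately show ?thesis using nonneg(1) by linarith
    next
      case False
      have "squares G / edges \<le> squares G / (\<Lambda> * n / \<theta>)"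
        using False \<Lambda>_pos n \<theta> e by (intro divide_left_mono squares_nonneg mult_pos_pos) auto
      also have "\<dots> = \<theta> / \<Lambda> / n * squares G" by simp
      finally show ?thesis using nonneg(2) by linarith
    qed
    also have "edges / n \<le> \<Lambda> + 1 + (gap G)\<^sup>2 / n\<^sup>2"
    proof -
      define x where "x = gap G / n"
      have "x * n = gap G" using n by (simp add: x_def)
      then have "edges = (\<Lambda> + x) * n" by (simp add: gap_def n_def algebra_simps)
      then have "edges / n = \<Lambda> + x" using n by simp
      \<comment> \<open>Replaces the relative gap by its square, the only quantity whose mean is
        controlled.\<close>
      moreover have "0 \<le> (x - 1 / 2)\<^sup>2" by simp
      then have "x \<le> 1 + x\<^sup>2" by (simp add: power2_eq_square algebra_simps)
      ultimately show ?thesis by (simp add: x_def power_divide)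
    qed
    finally show ?thesis by simp
  qed
qed

text \<open>The choice of \<open>\<theta>\<close> makes the coefficient
  \<open>2 * \<theta> / (1 + q) = (2 + q) / (1 + q)\<close>, which is below 2 exactly because
  \<open>q\<close> is positive. The tolerance \<open>\<theta> > 1\<close> absorbs fluctuations of
  the edge count.\<close>

lemma expectation_step_squares_le:
  assumes "good G"
  defines "n \<equiv> card (pverts G)" and "\<theta> \<equiv> 1 + q / 2"
  shows "measure_pmf.expectation (step G) squares
    \<le> (1 + 2 * \<theta> / (1 + q) / n) * squares G
      + (2 * \<mu> * (real n * ((gap G)\<^sup>2 / n\<^sup>2 / (\<Lambda> * (1 - 1 / \<theta>))\<^sup>2) + (\<Lambda> + 1 + (gap G)\<^sup>2 / n\<^sup>2))
        + \<mu> + avg n (\<lambda>m. (real m)\<^sup>2))"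
proof -
  interpret growth_step p q G by fact
  define X where "X = (\<Sum>v\<in>V. w v * deg v)"
  define Y where "Y = real n * ((gap G)\<^sup>2 / n\<^sup>2 / (\<Lambda> * (1 - 1 / \<theta>))\<^sup>2) + (\<Lambda> + 1 + (gap G)\<^sup>2 / n\<^sup>2)"
  have X0: "0 \<le> X" by (simp add: X_def sum_nonneg)
  have X: "X \<le> \<theta> / \<Lambda> / n * squares G + Y"
    using sum_w_deg_le [OF assms(1)] by (simp add: X_def Y_def n_def \<theta>_def)
  have "measure_pmf.expectation (step G) squares
    \<le> avg n (\<lambda>m. squares G + real m * (2 * X + 1) + (real m)\<^sup>2)"
    unfolding expectation_step [OF assms(1)] n_def [symmetric]
  proof (rule avg_mono)
    fix m assume "m \<le> n"
    then have m: "min m nodes = m" by (simp add: n_def)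
    show "measure_pmf.expectation (evolve p q m G) squares \<le> squares G + real m * (2 * X + 1) + (real m)\<^sup>2"
      using expectation_evolve_squares_le [of m] unfolding m squares_def X_def .
  qed
  also have "\<dots> = squares G + avg n real * (2 * X + 1) + avg n (\<lambda>m. (real m)\<^sup>2)"
    using integrable_avg [of real n] integrable_avg [of "\<lambda>m. (real m)\<^sup>2" n] by simp
  also have "avg n real * (2 * X + 1) \<le> \<mu> * (2 * (\<theta> / \<Lambda> / n * squares G + Y) + 1)"
    using X X0 avg_le_\<mu> avg_nonneg \<mu>_pos by (intro mult_mono) auto
  also have "\<mu> * (2 * (\<theta> / \<Lambda> / n * squares G + Y) + 1)
      = 2 * \<theta> * (\<mu> / \<Lambda>) / n * squares G + (2 * \<mu> * Y + \<mu>)"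
    by (simp add: algebra_simps)
  also have "\<mu> / \<Lambda> = 1 / (1 + q)" using \<mu>_pos by (simp add: \<Lambda>_def)
  finally show ?thesis unfolding Y_def [symmetric] by (simp add: algebra_simps)
qed

definition selected :: "nat set \<Rightarrow> network \<Rightarrow> real" where
  "selected D G = avg (card (pverts G))
    (\<lambda>m. measure_pmf.expectation (select p G m) (\<lambda>S. real (card (S \<inter> D))))"

definition deg_class :: "nat \<Rightarrow> network \<Rightarrow> nat set" where
  "deg_class k G = {v \<in> pverts G. in_degree G v = k}"

text \<open>The rate equation: selected nodes of in-degree \<open>k - 1\<close> enter the class,
  selected nodes of in-degree \<open>k\<close> leave it, and the new node may be born into
  it.\<close>

lemma expectation_step_deg_count:
  assumes "good G"
  defines "n \<equiv> card (pverts G)"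
  shows "measure_pmf.expectation (step G) (deg_count k) = deg_count k G
    + (case k of 0 \<Rightarrow> 0 | Suc j \<Rightarrow> selected (deg_class j G) G) - selected (deg_class k G) G + born n k"
proof -
  interpret growth_step p q G by fact
  define D where "D = (case k of 0 \<Rightarrow> {} | Suc j \<Rightarrow> deg_class j G)"
  define E where "E D m = measure_pmf.expectation (select p G m) (\<lambda>S. real (card (S \<inter> D)))" for D m
  have "measure_pmf.expectation (step G) (deg_count k)
    = avg n (\<lambda>m. deg_count k G + (E D m - E (deg_class k G) m) + pmf (binomial_pmf m q) k)"
    unfolding expectation_step [OF assms(1)] n_def [symmetric]
  proof (rule expectation_cong_pmf)
    fix a
    define m where "m = min a n"
    have m: "min m nodes = m" "m \<le> nodes" by (auto simp: m_def n_def)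
    define F :: "nat \<Rightarrow> real" where "F d = (if d = k then 1 else 0)" for d
    have "measure_pmf.expectation (select p G m) (\<lambda>S. \<Sum>v\<in>S. F (Suc (in_degree G v)) - F (in_degree G v))
      = measure_pmf.expectation (select p G m) (\<lambda>S. real (card (S \<inter> D)) - real (card (S \<inter> deg_class k G)))"
    proof (rule expectation_cong_pmf)
      fix S assume "S \<in> set_pmf (select p G m)"
      then have S: "S \<subseteq> V" using set_select m by blast
      then have fin: "finite S" using finite_subset finite_V by blast
      have "(\<Sum>v\<in>S. F (Suc (in_degree G v))) = real (card {v \<in> S. Suc (in_degree G v) = k})"
        "(\<Sum>v\<in>S. F (in_degree G v)) = real (card {v \<in> S. in_degree G v = k})"
        using fin by (simp_all add: F_def sum.If_cases Int_def)
      moreover have "{v \<in> S. Suc (in_degree G v) = k} = S \<inter> D"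
        using S by (auto simp: D_def deg_class_def split: nat.splits)
      moreover have "{v \<in> S. in_degree G v = k} = S \<inter> deg_class k G"
        using S by (auto simp: deg_class_def)
      ultimately show "(\<Sum>v\<in>S. F (Suc (in_degree G v)) - F (in_degree G v))
        = real (card (S \<inter> D)) - real (card (S \<inter> deg_class k G))"
        by (simp add: sum_subtractf)
    qed
    also have "\<dots> = E D m - E (deg_class k G) m"
      using m by (simp add: E_def integrable_measure_pmf_finite finite_set_select)
    finally have "measure_pmf.expectation (select p G m)
        (\<lambda>S. \<Sum>v\<in>S. F (Suc (in_degree G v)) - F (in_degree G v)) = E D m - E (deg_class k G) m" .
    moreover have "measure_pmf.expectation (binomial_pmf m q) F = pmf (binomial_pmf m q) k"
      by (subst integral_measure_pmf_real [of "{k}"]) (auto simp: F_def simp del: pmf_binomial split: if_splits)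
    moreover have "deg_count k = degree_sum F" by (simp add: deg_count_def F_def [abs_def])
    ultimately show "measure_pmf.expectation (evolve p q (min a n) G) (deg_count k)
      = deg_count k G + (E D (min a n) - E (deg_class k G) (min a n)) + pmf (binomial_pmf (min a n) q) k"
      using expectation_evolve_sum_in_degree [of m F] unfolding m m_def [symmetric] by simp
  qed
  also have "\<dots> = deg_count k G + (selected D G - selected (deg_class k G) G) + born n k"
    using integrable_avg [of "E D" n] integrable_avg [of "E (deg_class k G)" n]
      integrable_avg [of "\<lambda>m. pmf (binomial_pmf m q) k" n]
    by (simp add: selected_def E_def [abs_def] n_def [symmetric] born_def del: pmf_binomial)
  also have "selected D G = (case k of 0 \<Rightarrow> 0 | Suc j \<Rightarrow> selected (deg_class j G) G)"
    by (simp add: D_def selected_def split: nat.splits)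
  finally show ?thesis by simp
qed

text \<open>The limiting mean number of edges per step times the attachment weight of a node of
  in-degree \<open>k\<close>, scaled by \<open>n\<close>, when the edge count is exactly
  \<open>\<Lambda> * n\<close>.\<close>

definition rate :: "nat \<Rightarrow> real" where
  "rate k = \<mu> * (p * k / \<Lambda> + (1 - p))"

lemma rate_nonneg: "0 \<le> rate k"
  using p \<mu>_pos \<Lambda>_pos by (simp add: rate_def)

text \<open>Replacing \<open>edges\<close> by \<open>\<Lambda> * n\<close> costs
  \<open>p * (k * N / edges)\<close> times the relative gap over \<open>\<Lambda>\<close>, up to
  sign. The class contributes \<open>k * N\<close> to the total in-degree, so
  \<open>k * N / edges\<close> is at most 1 and the bound is uniform in \<open>k\<close>.\<close>

lemma deg_class_mass:
  assumes "good G"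
  defines "n \<equiv> card (pverts G)"
  shows "\<bar>(\<Sum>v\<in>deg_class k G. pmf (attach_pmf p G) v) - (p * k / \<Lambda> + (1 - p)) * (deg_count k G / n)\<bar>
    \<le> \<bar>gap G\<bar> / n / \<Lambda>"
proof -
  interpret growth_step p q G by fact
  have n: "n > 0" using nodes_pos by (simp add: n_def)
  define N where "N = real (card (deg_class k G))"
  have fin: "finite (deg_class k G)" by (simp add: deg_class_def)
  have N: "deg_count k G = N"
    by (simp add: N_def deg_count_def degree_sum_def deg_class_def sum.If_cases Int_def)
  have N_le: "N \<le> n"
    by (simp add: N_def n_def deg_class_def card_mono)
  have kN: "k * N \<le> edges"
  proof -
    have "k * N = (\<Sum>v\<in>deg_class k G. deg v)"
      by (simp add: deg_class_def N_def)
    also have "\<dots> \<le> edges"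
      unfolding edges_eq by (intro sum_mono2) (auto simp: deg_class_def)
    finally show ?thesis .
  qed
  show ?thesis
  proof (cases "edges = 0")
    \<comment> \<open>Without edges attachment is uniform and the right-hand side is exactly 1. The
      error is \<open>p * (N / n)\<close>, because \<open>k * N\<close> vanishes.\<close>
    case True
    have "(\<Sum>v\<in>deg_class k G. w v) = (\<Sum>v\<in>deg_class k G. 1 / n)"
      using True by (intro sum.cong refl) (simp add: w_uniform n_def deg_class_def)
    then have "(\<Sum>v\<in>deg_class k G. w v) = N / n" by (simp add: N_def)
    moreover have "0 \<le> k * N" by (simp add: N_def)
    then have "k * N = 0" using kN True by linarith
    then have "(p * k / \<Lambda> + (1 - p)) * (deg_count k G / n) = (1 - p) * (N / n)"
      unfolding N by (auto simp: algebra_simps diff_divide_distrib)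
    moreover have "N / n - (1 - p) * (N / n) = p * (N / n)" by (simp add: algebra_simps diff_divide_distrib)
    moreover have "\<bar>p * (N / n)\<bar> \<le> 1"
    proof -
      have "0 \<le> N / n" "N / n \<le> 1" using N_le n by (simp_all add: N_def)
      then have "0 \<le> p * (N / n)" "p * (N / n) \<le> 1"
        using p by (auto intro: mult_le_one simp del: times_divide_eq_right)
      then show ?thesis by linarith
    qed
    moreover have "\<bar>gap G\<bar> / n / \<Lambda> = 1"
      using True \<Lambda>_pos n nonempty by (simp add: gap_def n_def abs_mult)
    ultimately show ?thesis by (simp only:)
  next
    case False
    then have e: "edges > 0" by simp
    have "(\<Sum>v\<in>deg_class k G. w v) = (\<Sum>v\<in>deg_class k G. p * (k / edges) + (1 - p) / n)"
      using False by (intro sum.cong refl) (simp add: w_mixed n_def deg_class_def)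
    also have "\<dots> = N * (p * (k / edges) + (1 - p) / n)" by (simp add: N_def)
    finally have "(\<Sum>v\<in>deg_class k G. w v) - (p * k / \<Lambda> + (1 - p)) * (deg_count k G / n)
      = p * k * N * (1 / edges - 1 / (\<Lambda> * n))"
      unfolding N by (simp add: algebra_simps diff_divide_distrib add_divide_distrib)
    also have "1 / edges - 1 / (\<Lambda> * n) = (\<Lambda> * n - edges) / (edges * \<Lambda> * n)"
      using e n \<Lambda>_pos by (simp add: diff_divide_distrib)
    also have "\<Lambda> * n - edges = - gap G" by (simp add: gap_def n_def)
    also have "p * k * N * (- gap G / (edges * \<Lambda> * n)) = p * (k * N / edges) * (- gap G / n / \<Lambda>)"
      by (simp add: mult_ac)
    also have "\<bar>\<dots>\<bar> \<le> 1 * (\<bar>gap G\<bar> / n / \<Lambda>)"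
    proof -
      have "0 \<le> k * N / edges" "k * N / edges \<le> 1" using kN e by (simp_all add: N_def)
      then have "0 \<le> p * (k * N / edges)" "p * (k * N / edges) \<le> 1"
        using p by (auto intro: mult_le_one simp del: times_divide_eq_right)
      then have "\<bar>p * (k * N / edges)\<bar> \<le> 1" by linarith
      then have "\<bar>p * (k * N / edges)\<bar> * (\<bar>gap G\<bar> / n / \<Lambda>) \<le> 1 * (\<bar>gap G\<bar> / n / \<Lambda>)"
        using \<Lambda>_pos by (intro mult_right_mono) auto
      then show ?thesis using \<Lambda>_pos by (simp add: abs_mult)
    qed
    finally show ?thesis by simp
  qed
qed

text \<open>Three errors add up: drawing without replacement, truncating \<open>A\<close> at
  \<open>n\<close>, and replacing the edge count by \<open>\<Lambda> * n\<close>. The level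
  \<open>L\<close> is free and is chosen before the time tends to infinity.\<close>

lemma selected_approx:
  assumes "good G" and L: "L > 0"
  defines "n \<equiv> card (pverts G)"
  shows "\<bar>selected (deg_class k G) G - rate k * (deg_count k G / n)\<bar>
    \<le> tail_mean L + (real L)\<^sup>2 * concentration G + (\<mu> - avg n real)
      + \<mu> / \<Lambda> * (1 / L + L * ((gap G)\<^sup>2 / n\<^sup>2))"
proof -
  interpret growth_step p q G by fact
  have n: "n > 0" using nodes_pos by (simp add: n_def)
  define W where "W = (\<Sum>v\<in>deg_class k G. w v)"
  define E where "E m = measure_pmf.expectation (select p G m) (\<lambda>S. real (card (S \<inter> deg_class k G)))" for m
  have W: "0 \<le> W" "W \<le> 1"
    using sum_w sum_mono2 [of V "deg_class k G" "\<lambda>v. w v"]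
    by (auto simp: W_def deg_class_def sum_nonneg)
  have "selected (deg_class k G) G - avg n real * W = avg n (\<lambda>m. E m - m * W)"
    using integrable_avg [of E n] integrable_avg [of real n]
    by (simp add: selected_def E_def [abs_def] n_def [symmetric])
  then have "\<bar>selected (deg_class k G) G - avg n real * W\<bar> \<le> avg n (\<lambda>m. \<bar>E m - m * W\<bar>)"
    by (simp only: integral_abs_bound)
  also have "\<dots> \<le> avg n (\<lambda>m. min (real m) ((real m)\<^sup>2 * concentration G))"
  proof (rule avg_mono)
    fix m assume "m \<le> n"
    then show "\<bar>E m - m * W\<bar> \<le> min (real m) ((real m)\<^sup>2 * concentration G)"
      using expectation_select_card_bounds [of "deg_class k G" m]
      by (simp add: E_def W_def n_def concentration_def deg_class_def)
  qed
  also have "\<dots> \<le> tail_mean L + (real L)\<^sup>2 * concentration G"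
    by (intro avg_min_le concentration_nonneg)
  finally have 1: "\<bar>selected (deg_class k G) G - avg n real * W\<bar> \<le> tail_mean L + (real L)\<^sup>2 * concentration G" .
  have "\<bar>(\<mu> - avg n real) * W\<bar> \<le> (\<mu> - avg n real) * 1"
    using W avg_le_\<mu> [of n] unfolding abs_mult by (intro mult_mono) auto
  then have 2: "\<bar>avg n real * W - \<mu> * W\<bar> \<le> \<mu> - avg n real"
    by (simp add: algebra_simps abs_minus_commute)
  have "\<mu> * \<bar>W - (p * k / \<Lambda> + (1 - p)) * (deg_count k G / n)\<bar> \<le> \<mu> * (\<bar>gap G\<bar> / n / \<Lambda>)"
    using deg_class_mass [OF assms(1), of k] \<mu>_pos
    by (intro mult_left_mono) (auto simp: W_def n_def)
  then have "\<bar>\<mu> * (W - (p * k / \<Lambda> + (1 - p)) * (deg_count k G / n))\<bar> \<le> \<mu> / \<Lambda> * \<bar>gap G / n\<bar>"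
    using \<mu>_pos by (simp add: abs_mult mult_ac)
  also have "\<mu> * (W - (p * k / \<Lambda> + (1 - p)) * (deg_count k G / n)) = \<mu> * W - rate k * (deg_count k G / n)"
    by (simp add: rate_def algebra_simps)
  also have "\<mu> / \<Lambda> * \<bar>gap G / n\<bar> \<le> \<mu> / \<Lambda> * (1 / L + L * ((gap G)\<^sup>2 / n\<^sup>2))"
  proof (rule mult_left_mono)
    define x where "x = \<bar>gap G / n\<bar>"
    \<comment> \<open>Trades the absolute relative gap for its square at the price of
      \<open>1 / L\<close>.\<close>
    have "0 \<le> (1 - L * x)\<^sup>2 / L" by simp
    also have "\<dots> = 1 / L - 2 * x + L * x\<^sup>2"
      using L by (simp add: power2_eq_square field_simps)
    finally have "x \<le> 1 / L + L * x\<^sup>2" using abs_ge_zero [of "gap G / n"] unfolding x_def by linarith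
    then show "\<bar>gap G / n\<bar> \<le> 1 / L + L * ((gap G)\<^sup>2 / n\<^sup>2)" by (simp add: x_def power_divide)
  qed (use \<mu>_pos \<Lambda>_pos in auto)
  finally have 3: "\<bar>\<mu> * W - rate k * (deg_count k G / n)\<bar> \<le> \<mu> / \<Lambda> * (1 / L + L * ((gap G)\<^sup>2 / n\<^sup>2))" .
  show ?thesis using 1 2 3 unfolding of_nat_power by linarith
qed

end

section \<open>Convergence of the expected degree distribution\<close>

context growth_process
begin

text \<open>The Markov chain from a fixed network. It will start from the network at time 1, because
  the first step is tied to the seed through the first value of \<open>A\<close>.\<close>

primrec chain :: "network \<Rightarrow> nat \<Rightarrow> network pmf" where
  "chain G 0 = return_pmf G"
| "chain G (Suc t) = bind_pmf (chain G t) step"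

lemma set_chain:
  assumes "good G"
  shows "H \<in> set_pmf (chain G t) \<Longrightarrow> good H \<and> card (pverts H) = card (pverts G) + t"
proof (induction t arbitrary: H)
  case (Suc t)
  then obtain H' where H': "H' \<in> set_pmf (chain G t)" "H \<in> set_pmf (step H')" by auto
  then show ?case using Suc.IH [OF H'(1)] good_step [of H' H] by simp
qed (use assms in auto)

lemma finite_set_chain: "good G \<Longrightarrow> finite (set_pmf (chain G t))"
proof (induction t)
  case (Suc t)
  then show ?case using set_chain [OF Suc.prems] finite_set_step by simp
qed simp

lemma network_pmf_eq_chain:
  "network_pmf p q A seed (Suc t) = bind_pmf (network_pmf p q A seed 1) (\<lambda>G. chain G t)"
proof (induction t)
  case (Suc t)
  have "network_pmf p q A seed (Suc (Suc t)) = bind_pmf (network_pmf p q A seed (Suc t)) step"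
    by (simp add: step_def [abs_def])
  then show ?case unfolding Suc.IH by (simp add: bind_assoc_pmf)
qed (simp add: bind_return_pmf')

end

section \<open>The expected statistics along the chain\<close>

locale growth_chain = growth_process +
  fixes G :: network
  assumes good: "growth_step p q G"
begin

abbreviation E :: "nat \<Rightarrow> (network \<Rightarrow> real) \<Rightarrow> real" where
  "E t h \<equiv> measure_pmf.expectation (chain G t) h"

abbreviation size_at :: "nat \<Rightarrow> nat" where
  "size_at t \<equiv> card (pverts G) + t"

lemma size_pos: "card (pverts G) > 0"
  using growth_step.nodes_pos [OF good] .

lemma E_Suc: "E (Suc t) h = E t (\<lambda>H. measure_pmf.expectation (step H) h)"
  using finite_set_chain [OF good, of "Suc t"] by (simp add: expectation_bind_pmf_finite)

lemma integrable_E [simp]: "integrable (measure_pmf (chain G t)) (h :: network \<Rightarrow> real)"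
  by (intro integrable_measure_pmf_finite finite_set_chain good)

lemma E_mono:
  "(\<And>H. good H \<Longrightarrow> card (pverts H) = size_at t \<Longrightarrow> h H \<le> h' H) \<Longrightarrow> E t h \<le> E t h'"
  using set_chain [OF good] by (intro expectation_mono_pmf_finite finite_set_chain good) auto

lemma E_cong:
  "(\<And>H. good H \<Longrightarrow> card (pverts H) = size_at t \<Longrightarrow> h H = h' H) \<Longrightarrow> E t h = E t h'"
  using set_chain [OF good] by (intro expectation_cong_pmf) auto

lemma filterlim_size_at: "filterlim size_at at_top sequentially"
  using filterlim_add_const_nat_at_top [of "card (pverts G)"] by (simp add: add.commute)

lemma tendsto_const_over_size: "(\<lambda>t. c / real (size_at t)) \<longlonglongrightarrow> 0"
  using filterlim_compose [OF lim_const_over_n filterlim_size_at] .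

lemma avg_size_tendsto: "(\<lambda>t. avg (size_at t) real) \<longlonglongrightarrow> \<mu>"
  using filterlim_compose [OF avg_tendsto filterlim_size_at] .

lemma second_moment_size_tendsto: "(\<lambda>t. avg (size_at t) (\<lambda>m. (real m)\<^sup>2) / real (size_at t)) \<longlonglongrightarrow> 0"
  using filterlim_compose [OF second_moment_tendsto filterlim_size_at] .

text \<open>The quadratic recursion applies with \<open>c = 1\<close>, since the truncation deficit
  \<open>d\<close> is eventually below 1. The additive error is of smaller order than the size by
  the second-moment estimate.\<close>

lemma gap_tendsto: "(\<lambda>t. E t (\<lambda>H. (gap H)\<^sup>2) / (real (size_at t))\<^sup>2) \<longlonglongrightarrow> 0"
proof -
  define d where "d t = (\<mu> - avg (size_at t) real) * (1 + q)" for t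
  define s where "s t = avg (size_at t) (\<lambda>m. (real m)\<^sup>2)" for t
  define \<delta> where "\<delta> t = d t + 8 * (s t / size_at t) + 2 * \<Lambda>\<^sup>2 / size_at t" for t
  have d: "d \<longlonglongrightarrow> (\<mu> - \<mu>) * (1 + q)"
    unfolding d_def by (intro tendsto_intros avg_size_tendsto)
  show ?thesis
  proof (rule quadratic_recursion_tendsto_0 [where c = 1 and \<delta> = \<delta>])
    have "\<delta> \<longlonglongrightarrow> (\<mu> - \<mu>) * (1 + q) + 8 * 0 + 0"
      unfolding \<delta>_def s_def by (intro tendsto_intros d second_moment_size_tendsto tendsto_const_over_size)
    then show "\<delta> \<longlonglongrightarrow> 0" by simp
    have "\<forall>\<^sub>F t in sequentially. d t < 1"
      using order_tendstoD(2) [OF d, of 1] by simp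
    then show "\<forall>\<^sub>F t in sequentially. E (Suc t) (\<lambda>H. (gap H)\<^sup>2)
      \<le> (1 + 1 / real (size_at t)) * E t (\<lambda>H. (gap H)\<^sup>2) + \<delta> t * real (size_at t)"
    proof eventually_elim
      case (elim t)
      have n: "real (size_at t) > 0" using size_pos by simp
      have "E (Suc t) (\<lambda>H. (gap H)\<^sup>2)
        \<le> E t (\<lambda>H. (1 + d t / size_at t) * (gap H)\<^sup>2 + (d t * size_at t + 8 * s t + 2 * \<Lambda>\<^sup>2))"
        unfolding E_Suc d_def s_def by (rule E_mono) (metis expectation_step_gap_le)
      also have "\<dots> = (1 + d t / size_at t) * E t (\<lambda>H. (gap H)\<^sup>2) + (d t * size_at t + 8 * s t + 2 * \<Lambda>\<^sup>2)"
        by simp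
      also have "\<dots> \<le> (1 + 1 / size_at t) * E t (\<lambda>H. (gap H)\<^sup>2) + (d t * size_at t + 8 * s t + 2 * \<Lambda>\<^sup>2)"
        using elim n
        by (intro add_right_mono mult_right_mono add_left_mono divide_right_mono) auto
      also have "d t * size_at t + 8 * s t + 2 * \<Lambda>\<^sup>2 = \<delta> t * size_at t"
        using n unfolding \<delta>_def by (simp only: distrib_right) simp
      finally show ?case .
    qed
  qed auto
qed

text \<open>The quadratic recursion applies because its coefficient is below 2. The additive error
  is of smaller order than the size because the mean squared relative gap tends to 0.\<close>

lemma squares_tendsto: "(\<lambda>t. E t squares / (real (size_at t))\<^sup>2) \<longlonglongrightarrow> 0"
proof -
  define \<theta> where "\<theta> = 1 + q / 2"
  define K where "K = (\<Lambda> * (1 - 1 / \<theta>))\<^sup>2"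
  define v where "v t = E t (\<lambda>H. (gap H)\<^sup>2) / (real (size_at t))\<^sup>2" for t
  define s where "s t = avg (size_at t) (\<lambda>m. (real m)\<^sup>2)" for t
  define \<delta> where "\<delta> t = 2 * \<mu> * (v t / K)
    + (2 * \<mu> * (\<Lambda> + 1) + \<mu>) / size_at t + 2 * \<mu> * v t * (1 / size_at t) + s t / size_at t" for t
  have v: "v \<longlonglongrightarrow> 0" unfolding v_def by (rule gap_tendsto)
  show ?thesis
  proof (rule quadratic_recursion_tendsto_0 [where c = "2 * \<theta> * (1 / (1 + q))" and \<delta> = \<delta>])
    show "2 * \<theta> * (1 / (1 + q)) < 2" using q by (simp add: \<theta>_def field_simps)
    have "\<delta> \<longlonglongrightarrow> 2 * \<mu> * (0 / K) + 0 + 2 * \<mu> * 0 * 0 + 0"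
      unfolding \<delta>_def s_def divide_inverse [of _ K]
      by (intro tendsto_intros v second_moment_size_tendsto tendsto_const_over_size)
    then show "\<delta> \<longlonglongrightarrow> 0" by simp
    show "\<forall>\<^sub>F t in sequentially. E (Suc t) squares
      \<le> (1 + 2 * \<theta> * (1 / (1 + q)) / real (size_at t)) * E t squares + \<delta> t * real (size_at t)"
    proof (rule always_eventually, rule allI)
      fix t
      define n where "n = real (size_at t)"
      have n: "n > 0" using size_pos by (simp add: n_def)
      have "E (Suc t) squares \<le> E t (\<lambda>H. (1 + 2 * \<theta> * (1 / (1 + q)) / n) * squares H
        + (2 * \<mu> * (n * ((gap H)\<^sup>2 / n\<^sup>2 / K) + (\<Lambda> + 1 + (gap H)\<^sup>2 / n\<^sup>2)) + \<mu> + s t))"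
        unfolding E_Suc
      proof (rule E_mono)
        fix H assume H: "good H" "card (pverts H) = size_at t"
        show "measure_pmf.expectation (step H) squares \<le> (1 + 2 * \<theta> * (1 / (1 + q)) / n) * squares H
          + (2 * \<mu> * (n * ((gap H)\<^sup>2 / n\<^sup>2 / K) + (\<Lambda> + 1 + (gap H)\<^sup>2 / n\<^sup>2)) + \<mu> + s t)"
          using expectation_step_squares_le [OF H(1)]
          unfolding H(2) of_nat_power n_def [symmetric] s_def [symmetric] \<theta>_def [symmetric] K_def [symmetric] by simp
      qed
      also have "\<dots> = (1 + 2 * \<theta> * (1 / (1 + q)) / n) * E t squares
        + (2 * \<mu> * (n * (v t / K) + (\<Lambda> + 1 + v t)) + \<mu> + s t)"
        by (simp add: v_def n_def)
      also have "2 * \<mu> * (n * (v t / K) + (\<Lambda> + 1 + v t)) + \<mu> + s t = \<delta> t * n"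
      proof -
        have "\<delta> t * n = 2 * \<mu> * (v t / K) * n + (2 * \<mu> * (\<Lambda> + 1) + \<mu>) + 2 * \<mu> * v t + s t"
          using n unfolding \<delta>_def n_def [symmetric] by (simp only: distrib_right) simp
        then show ?thesis by (simp add: algebra_simps)
      qed
      finally show "E (Suc t) squares
        \<le> (1 + 2 * \<theta> * (1 / (1 + q)) / real (size_at t)) * E t squares + \<delta> t * real (size_at t)"
        by (simp add: n_def)
    qed
  qed (auto simp: integral_nonneg squares_nonneg)
qed

lemma concentration_tendsto: "(\<lambda>t. E t concentration) \<longlonglongrightarrow> 0"
proof (rule tendsto_sandwich)
  show "\<forall>\<^sub>F t in sequentially. 0 \<le> E t concentration"
    by (simp add: integral_nonneg concentration_nonneg)
  show "\<forall>\<^sub>F t in sequentially. E t concentration \<le> 1 / size_at t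
    + 4 / \<Lambda>\<^sup>2 * (E t squares / (real (size_at t))\<^sup>2 + E t (\<lambda>H. (gap H)\<^sup>2) / (real (size_at t))\<^sup>2)"
  proof (rule always_eventually, rule allI)
    fix t
    have "E t concentration \<le> E t (\<lambda>H. 1 / size_at t
        + 4 / \<Lambda>\<^sup>2 * (squares H / (real (size_at t))\<^sup>2 + (gap H)\<^sup>2 / (real (size_at t))\<^sup>2))"
      by (rule E_mono) (metis concentration_le)
    then show "E t concentration \<le> 1 / size_at t
      + 4 / \<Lambda>\<^sup>2 * (E t squares / (real (size_at t))\<^sup>2 + E t (\<lambda>H. (gap H)\<^sup>2) / (real (size_at t))\<^sup>2)"
      by simp
  qed
  have "(\<lambda>t. 1 / size_at t
    + 4 / \<Lambda>\<^sup>2 * (E t squares / (real (size_at t))\<^sup>2 + E t (\<lambda>H. (gap H)\<^sup>2) / (real (size_at t))\<^sup>2))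
    \<longlonglongrightarrow> 0 + 4 / \<Lambda>\<^sup>2 * (0 + 0)"
    by (intro tendsto_intros tendsto_const_over_size squares_tendsto gap_tendsto)
  then show "(\<lambda>t. 1 / size_at t
    + 4 / \<Lambda>\<^sup>2 * (E t squares / (real (size_at t))\<^sup>2 + E t (\<lambda>H. (gap H)\<^sup>2) / (real (size_at t))\<^sup>2))
    \<longlonglongrightarrow> 0" by simp
qed simp

text \<open>A double limit: first \<open>L\<close> is chosen to make the tail mean and the
  \<open>1 / L\<close> term small, then \<open>t\<close> grows with \<open>L\<close> fixed.\<close>

lemma selected_tendsto:
  "(\<lambda>t. E t (\<lambda>H. selected (deg_class k H) H) - rate k * (E t (deg_count k) / size_at t)) \<longlonglongrightarrow> 0"
proof (rule LIMSEQ_I)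
  fix r :: real assume r: "r > 0"
  define v where "v t = E t (\<lambda>H. (gap H)\<^sup>2) / (real (size_at t))\<^sup>2" for t
  \<comment> \<open>The part of the bound in \<open>selected_approx\<close> that vanishes as
    \<open>t\<close> grows, for each fixed \<open>L\<close>.\<close>
  define err where "err L t = (real L)\<^sup>2 * E t concentration + (\<mu> - avg (size_at t) real)
    + \<mu> / \<Lambda> * (L * v t)" for L t
  have "(\<lambda>L. tail_mean L + \<mu> / \<Lambda> * (1 / real L)) \<longlonglongrightarrow> 0 + \<mu> / \<Lambda> * 0"
    by (intro tendsto_intros tail_mean_tendsto lim_const_over_n)
  from order_tendstoD(2) [OF this, of "r / 2"]
  have "\<forall>\<^sub>F L in sequentially. tail_mean L + \<mu> / \<Lambda> * (1 / real L) < r / 2"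
    using r by simp
  then have "\<forall>\<^sub>F L in sequentially. tail_mean L + \<mu> / \<Lambda> * (1 / real L) < r / 2 \<and> L > 0"
    using eventually_gt_at_top by (rule eventually_conj)
  then obtain L where L: "tail_mean L + \<mu> / \<Lambda> * (1 / real L) < r / 2" "L > 0"
    using eventually_happens by fastforce
  have "err L \<longlonglongrightarrow> (real L)\<^sup>2 * 0 + (\<mu> - \<mu>) + \<mu> / \<Lambda> * (real L * 0)"
    unfolding err_def v_def by (intro tendsto_intros concentration_tendsto avg_size_tendsto gap_tendsto)
  from order_tendstoD(2) [OF this, of "r / 2"]
  have "\<forall>\<^sub>F t in sequentially. err L t < r / 2"
    using r by simp
  then have "\<forall>\<^sub>F t in sequentially. norm (E t (\<lambda>H. selected (deg_class k H) H)
    - rate k * (E t (deg_count k) / size_at t) - 0) < r"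
  proof eventually_elim
    case (elim t)
    have "E t (\<lambda>H. selected (deg_class k H) H) - rate k * (E t (deg_count k) / size_at t)
      = E t (\<lambda>H. selected (deg_class k H) H - rate k * (deg_count k H / size_at t))" by simp
    also have "\<bar>\<dots>\<bar> \<le> E t (\<lambda>H. \<bar>selected (deg_class k H) H - rate k * (deg_count k H / size_at t)\<bar>)"
      by (rule integral_abs_bound)
    also have "\<dots> \<le> E t (\<lambda>H. tail_mean L + (real L)\<^sup>2 * concentration H + (\<mu> - avg (size_at t) real)
      + \<mu> / \<Lambda> * (1 / L + L * ((gap H)\<^sup>2 / (real (size_at t))\<^sup>2)))"
      by (rule E_mono) (metis selected_approx L(2))
    also have "\<dots> = (tail_mean L + \<mu> / \<Lambda> * (1 / L)) + err L t"
      by (simp add: err_def v_def distrib_left)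
    also have "\<dots> < r" using L(1) elim by linarith
    finally show ?case by simp
  qed
  then show "\<exists>no. \<forall>t\<ge>no. norm (E t (\<lambda>H. selected (deg_class k H) H)
    - rate k * (E t (deg_count k) / size_at t) - 0) < r"
    by (simp only: eventually_sequentially)
qed

text \<open>Induction on \<open>k\<close>. Once the fraction of nodes of in-degree
  \<open>k - 1\<close> converges, so does the inflow from that class, and the fraction for
  \<open>k\<close> solves a linear recursion with outflow coefficient \<open>rate k\<close>.\<close>

lemma deg_count_convergent: "convergent (\<lambda>t. E t (deg_count k) / real (size_at t))"
proof (induction k)
  \<comment> \<open>Treats both cases of the induction at once; \<open>prev\<close> is the inflow
    from the class below, which is 0 for \<open>k = 0\<close>.\<close>
  have recursion: "convergent (\<lambda>t. E t (deg_count k) / real (size_at t))"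
    if prev: "prev \<longlonglongrightarrow> l" and step: "\<And>t. E (Suc t) (deg_count k)
      = E t (deg_count k) + prev t - E t (\<lambda>H. selected (deg_class k H) H) + born (size_at t) k"
    for k prev l
  proof -
    \<comment> \<open>Everything except the outflow
      \<open>rate k * (E t (deg_count k) / size_at t)\<close>; the bracket is the vanishing error of
      \<open>selected_tendsto\<close>.\<close>
    define b where "b t = prev t + born (size_at t) k
      - (E t (\<lambda>H. selected (deg_class k H) H) - rate k * (E t (deg_count k) / size_at t))" for t
    obtain \<beta> where "(\<lambda>n. born n k) \<longlonglongrightarrow> \<beta>" using born_tendsto by blast
    then have "(\<lambda>t. born (size_at t) k) \<longlonglongrightarrow> \<beta>"
      by (rule filterlim_compose [OF _ filterlim_size_at])
    then have "b \<longlonglongrightarrow> l + \<beta> - 0"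
      unfolding b_def by (intro tendsto_intros prev selected_tendsto)
    then have "(\<lambda>t. E t (deg_count k) / real (size_at t)) \<longlonglongrightarrow> (l + \<beta> - 0) / (1 + rate k)"
      by (rule linear_recursion_tendsto [OF size_pos rate_nonneg]) (simp add: step b_def del: chain.simps)
    then show ?thesis by (rule convergentI)
  qed
  have step: "E (Suc t) (deg_count k) = E t (deg_count k)
    + E t (\<lambda>H. case k of 0 \<Rightarrow> 0 | Suc j \<Rightarrow> selected (deg_class j H) H)
    - E t (\<lambda>H. selected (deg_class k H) H) + born (size_at t) k" for t k
  proof -
    have "E (Suc t) (deg_count k) = E t (\<lambda>H. deg_count k H
      + (case k of 0 \<Rightarrow> 0 | Suc j \<Rightarrow> selected (deg_class j H) H) - selected (deg_class k H) H
      + born (size_at t) k)"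
      unfolding E_Suc by (rule E_cong) (simp add: expectation_step_deg_count)
    then show ?thesis by simp
  qed
  {
    case 0
    show ?case using recursion [of "\<lambda>_. 0" 0 0] step [of _ 0] by simp
  next
    case (Suc k)
    then obtain l where "(\<lambda>t. E t (deg_count k) / real (size_at t)) \<longlonglongrightarrow> l"
      by (auto simp: convergent_def)
    then have "(\<lambda>t. (E t (\<lambda>H. selected (deg_class k H) H) - rate k * (E t (deg_count k) / size_at t))
      + rate k * (E t (deg_count k) / size_at t)) \<longlonglongrightarrow> 0 + rate k * l"
      by (intro tendsto_intros selected_tendsto)
    then have "(\<lambda>t. E t (\<lambda>H. selected (deg_class k H) H)) \<longlonglongrightarrow> rate k * l" by simp
    then show ?case using recursion [of _ _ "Suc k"] step [of _ "Suc k"] by simp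
  }
qed

lemma pmf_random_node_in_degree:
  assumes "good H"
  shows "pmf (random_node_in_degree H) k = deg_count k H / card (pverts H)"
proof -
  interpret H: growth_step p q H by fact
  have "pverts H \<inter> in_degree H -` {k} = {v \<in> pverts H. in_degree H v = k}" by auto
  then show ?thesis
    using H.nonempty
    by (simp add: random_node_in_degree_def pmf_map measure_pmf_of_set deg_count_def
        degree_sum_def sum.If_cases Int_def)
qed

lemma in_degree_chain_convergent:
  "convergent (\<lambda>t. pmf (bind_pmf (chain G t) random_node_in_degree) k)"
proof -
  \<comment> \<open>The size at time \<open>t\<close> is deterministic along the chain, so dividing
    by it commutes with the expectation.\<close>
  have "pmf (bind_pmf (chain G t) random_node_in_degree) k = E t (deg_count k) / real (size_at t)" for t
  proof -
    have "pmf (bind_pmf (chain G t) random_node_in_degree) k = E t (\<lambda>H. deg_count k H / size_at t)"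
      unfolding pmf_bind by (rule E_cong) (simp add: pmf_random_node_in_degree)
    then show ?thesis by simp
  qed
  then show ?thesis using deg_count_convergent by simp
qed

end

section \<open>Averaging over the network at time 1\<close>

theorem theorem3p2:
  fixes p q :: real and A :: "nat pmf" and seed :: "nat \<Rightarrow> network"
  assumes "0 \<le> p" and "p \<le> 1"
    and "0 < q" and "q \<le> 1"
    and "integrable (measure_pmf A) real"
    and "0 < measure_pmf.expectation A real"
    and "\<And>a. a \<in> set_pmf A \<Longrightarrow> pair_fin_digraph (seed a)"
    and "\<And>a. a \<in> set_pmf A \<Longrightarrow> a + 1 \<le> card (pverts (seed a))"
  shows "\<forall>k. convergent (\<lambda>t. pmf (in_degree_pmf p q A seed t) k)"
proof
  fix k
  interpret growth_process p q A using assms by unfold_locales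
  define Q where "Q = network_pmf p q A seed 1"
  have good_Q: "good G" if G: "G \<in> set_pmf Q" for G
  proof -
    obtain a where a: "a \<in> set_pmf A" "G \<in> set_pmf (evolve p q a (seed a))"
      using G by (auto simp: Q_def)
    have "pverts (seed a) \<noteq> {}" using assms(8) [OF a(1)] by auto
    then have "growth_step p q (seed a)"
      using assms(1-4) assms(7) [OF a(1)] by (simp add: growth_step_def)
    then interpret growth_step p q "seed a" .
    show ?thesis using set_evolve [OF a(2)] growth_step_grow by blast
  qed
  define P where "P t G = pmf (bind_pmf (chain G t) random_node_in_degree) k" for t G
  have law: "pmf (in_degree_pmf p q A seed (Suc t)) k = measure_pmf.expectation Q (P t)" for t
    unfolding in_degree_pmf_def network_pmf_eq_chain Q_def [symmetric]
    by (simp add: bind_assoc_pmf pmf_bind [of Q] P_def [abs_def])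
  have "(\<lambda>t. P t G) \<longlonglongrightarrow> lim (\<lambda>t. P t G)" if "G \<in> set_pmf Q" for G
  proof -
    interpret growth_chain p q A G
      by (intro growth_chain.intro growth_chain_axioms.intro growth_process_axioms good_Q that)
    show ?thesis
      using in_degree_chain_convergent [of k] by (simp add: P_def convergent_LIMSEQ_iff)
  qed
  \<comment> \<open>\<open>Q\<close> may have infinite support, so the limits for the individual
    networks are averaged by dominated convergence; probabilities are dominated by 1.\<close>
  then have "(\<lambda>t. measure_pmf.expectation Q (P t))
      \<longlonglongrightarrow> measure_pmf.expectation Q (\<lambda>G. lim (\<lambda>t. P t G))"
    by (rule expectation_tendsto_dominated [where g = "\<lambda>_. 1", rotated]) (auto simp: P_def pmf_le_1)
  then have "(\<lambda>t. pmf (in_degree_pmf p q A seed t) k)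
      \<longlonglongrightarrow> measure_pmf.expectation Q (\<lambda>G. lim (\<lambda>t. P t G))"
    unfolding law [symmetric] by (rule LIMSEQ_imp_Suc)
  then show "convergent (\<lambda>t. pmf (in_degree_pmf p q A seed t) k)"
    by (rule convergentI)
qed

end
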